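(* Let $\alpha,\beta\in\mathbb{R}$ be fixed and let $P_n^{(\alpha,\beta)}$ denote the Jacobi polynomial with index $n\in\mathbb{N}_0$ and parameters $\alpha,\beta$. For $x\in(-1,1)$, $$\lim_{N\to\infty}N\sum_{n=N+1}^\infty\frac{n!\,(2n+\alpha+\beta+1)\,\Gamma(n+\alpha+\beta+1)}{2^{\alpha+\beta+1}\,\Gamma(n+\alpha+1)\,\Gamma(n+\beta+1)}\,\frac{\left(P_n^{(\alpha,\beta)}(x)\right)^2}{n(n+\alpha+\beta+1)}=\frac{(1-x)^{-\alpha-\frac12}(1+x)^{-\beta-\frac12}}{\pi},$$ and, for $x,y\in(-1,1)$ with $x\neq y$ and for all $\gamma<2$, $$\lim_{N\to\infty}N^\gamma\sum_{n=N+1}^\infty\frac{n!\,(2n+\alpha+\beta+1)\,\Gamma(n+\alpha+\beta+1)}{2^{\alpha+\beta+1}\,\Gamma(n+\alpha+1)\,\Gamma(n+\beta+1)}\,\frac{P_n^{(\alpha,\beta)}(x)P_n^{(\alpha,\beta)}(y)}{n(n+\alpha+\beta+1)}=0.$$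
   Context: For $\alpha,\beta\in\mathbb{R}$, $n\in\mathbb{N}_0$ and $x\in[-1,1]$, the Jacobi polynomials are defined by $$P_n^{(\alpha,\beta)}(x)=\frac{1}{n!}\sum_{k=0}^n\binom{n}{k}(n+\alpha+\beta+1)_k\,(\alpha+k+1)_{n-k}\left(\frac{x-1}{2}\right)^k,$$ where $(z)_k=z(z+1)\cdots(z+k-1)$ is the rising Pochhammer symbol with $(z)_0=1$. For arbitrary real $\alpha,\beta$ the summands in the claim are well-defined for all sufficiently large $n$, and the limits are understood with $N$ sufficiently large. *)

theory Defs
  imports "HOL-Analysis.Analysis"
begin

definition jacobi_poly :: "real \<Rightarrow> real \<Rightarrow> nat \<Rightarrow> real \<Rightarrow> real" where
  "jacobi_poly \<alpha> \<beta> n x =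
     1 / fact n *
     (\<Sum>k=0..n. real (n choose k) * pochhammer (real n + \<alpha> + \<beta> + 1) k
        * pochhammer (\<alpha> + real k + 1) (n - k) * ((x - 1) / 2) ^ k)"

text \<open>For each \<open>\<alpha>\<close>, \<open>\<beta>\<close> there are at most finitely many \<open>n\<close> for which a Gamma function below is
  evaluated at a pole or the denominator \<open>n (n + \<alpha> + \<beta> + 1)\<close> vanishes; the values that the
  conventions \<open>Gamma z = 0\<close> at poles and \<open>a / 0 = 0\<close> give there do not affect sums over
  \<open>n > N\<close> with \<open>N\<close> large.\<close>

definition jacobi_summand :: "real \<Rightarrow> real \<Rightarrow> real \<Rightarrow> real \<Rightarrow> nat \<Rightarrow> real" where
  "jacobi_summand \<alpha> \<beta> x y n =
     fact n * (2 * real n + \<alpha> + \<beta> + 1) * Gamma (real n + \<alpha> + \<beta> + 1)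
       / (2 powr (\<alpha> + \<beta> + 1) * Gamma (real n + \<alpha> + 1) * Gamma (real n + \<beta> + 1))
     * (jacobi_poly \<alpha> \<beta> n x * jacobi_poly \<alpha> \<beta> n y / (real n * (real n + \<alpha> + \<beta> + 1)))"

end

theory Submission
  imports Defs "HOL-Real_Asymp.Real_Asymp"
begin

text \<open>
  Both limits follow from Darboux's asymptotic formula with its error term. For real
  \<open>\<alpha>\<close>, \<open>\<beta>\<close> and \<open>0 < \<theta> < \<pi>\<close>, put \<open>K = (2 sin (\<theta>/2))\<^sup>a (2 cos (\<theta>/2))\<^sup>b\<close> with \<open>a = \<alpha> + 1/2\<close>,
  \<open>b = \<beta> + 1/2\<close>, put \<open>\<psi>\<^sub>n = (n + (a + b)/2) \<theta> - a \<pi>/2\<close>, and let \<open>\<lambda>\<^sub>n\<close> be the coefficient of \<open>x\<^sup>n\<close>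
  in \<open>P\<^sub>n(x)\<close>, divided by \<open>2\<^sup>n\<close>. Then
  \<open>K P\<^sub>n(cos \<theta>) = 2 \<lambda>\<^sub>n cos \<psi>\<^sub>n + O(\<lambda>\<^sub>n / n)\<close>; this is \<open>jacobi_darboux\<close>.

  The formula holds for all real parameters, because it is a connection problem that never meets
  the end points \<open>x = 1\<close> and \<open>x = -1\<close>. Write \<open>x = (z + 1/z)/2\<close>. On the unit circle \<open>x = cos \<theta>\<close>, and
  \<open>z\<^sup>n P\<^sub>n(x)\<close> is a polynomial in \<open>z\<close> whose value at \<open>z = 0\<close> is \<open>\<lambda>\<^sub>n\<close>. After multiplication by
  \<open>(1 - z)\<^sup>a (1 + z)\<^sup>b\<close>, the Jacobi equation has no first-order term except the one with the large
  parameter: with \<open>D = z d/dz\<close> and \<open>M = n + (a + b)/2\<close> it reads \<open>D\<^sup>2 v - 2 M D v = q v\<close>, where \<open>q\<close> does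
  not depend on \<open>n\<close> and vanishes at \<open>z = 0\<close>. Along the ray from \<open>0\<close> to \<open>e\<^sup>-\<^sup>i\<^sup>\<theta>\<close> the quantity
  \<open>2 M v - D v\<close> therefore changes only by \<open>O(\<lambda>\<^sub>n)\<close>, while it starts at \<open>2 M \<lambda>\<^sub>n\<close>. At the end of the ray,
  its real part, after removal of a phase, is \<open>M K P\<^sub>n(cos \<theta>)\<close>.

  In the series, the normalising factor and \<open>\<lambda>\<^sub>n\<^sup>2\<close> combine to an amplitude \<open>T\<^sub>n\<close> that is
  eventually decreasing, with \<open>n\<^sup>2 T\<^sub>n\<close> tending to \<open>2\<^sup>\<alpha>\<^sup>+\<^sup>\<beta> / \<pi>\<close> (\<open>jacobi_amplitude_asymp\<close>, from
  Legendre's duplication formula). The product of two cosines splits into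
  \<open>cos (n (\<theta> - \<phi>) + \<dots>)\<close> and \<open>cos (n (\<theta> + \<phi>) + \<dots>)\<close>. By partial summation
  (\<open>oscillating_tail\<close>) a non-constant cosine contributes \<open>O(N\<^sup>-\<^sup>2)\<close> to the tail of the series, and
  so does the error term, which is \<open>O(n\<^sup>-\<^sup>3)\<close> (\<open>cube_tail\<close>). Hence the tail is \<open>O(N\<^sup>-\<^sup>2)\<close> for \<open>x \<noteq> y\<close>.
  For \<open>x = y\<close> the first cosine is \<open>1\<close>, and the tail of \<open>T\<^sub>n\<close> itself, of order \<open>1/N\<close>, gives the
  first limit.
\<close>

section \<open>The Jacobi equation\<close>

definition jacobi_coeff :: "real \<Rightarrow> real \<Rightarrow> nat \<Rightarrow> nat \<Rightarrow> real" where
  "jacobi_coeff \<alpha> \<beta> n k =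
     real (n choose k) * pochhammer (real n + \<alpha> + \<beta> + 1) k
       * pochhammer (\<alpha> + real k + 1) (n - k) / fact n"

lemma jacobi_poly_eq_sum_coeff:
  "jacobi_poly \<alpha> \<beta> n x = (\<Sum>k\<le>n. jacobi_coeff \<alpha> \<beta> n k * ((x - 1) / 2) ^ k)"
  unfolding jacobi_poly_def jacobi_coeff_def sum_distrib_left atMost_atLeast0
  by (intro sum.cong) auto

text \<open>The hypergeometric recurrence of the coefficients, multiplied out so that it also holds where
  \<open>\<alpha> + k + 1 = 0\<close>.\<close>
lemma jacobi_coeff_Suc:
  "real (Suc k) * (\<alpha> + real k + 1) * jacobi_coeff \<alpha> \<beta> n (Suc k)
   = (real n - real k) * (real n + real k + \<alpha> + \<beta> + 1) * jacobi_coeff \<alpha> \<beta> n k"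
proof (cases "k < n")
  case True
  then obtain d where d: "n - k = Suc d" "n - Suc k = d"
    by (metis Suc_diff_Suc)
  have poch: "pochhammer (\<alpha> + real k + 1) (n - k)
      = (\<alpha> + real k + 1) * pochhammer (\<alpha> + real (Suc k) + 1) (n - Suc k)"
    unfolding d pochhammer_rec by (simp add: algebra_simps)
  have "Suc k * (n choose Suc k) = (n - k) * (n choose k)"
    using binomial_absorb_comp[of n k] binomial_absorption[of k n] by simp
  then have binom: "real (Suc k) * real (n choose Suc k) = (real n - real k) * real (n choose k)"
    using True by (metis of_nat_diff of_nat_mult less_imp_le)
  have "real (Suc k) * (\<alpha> + real k + 1) * jacobi_coeff \<alpha> \<beta> n (Suc k)
    = (real (Suc k) * real (n choose Suc k)) * pochhammer (real n + \<alpha> + \<beta> + 1) (Suc k)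
       * ((\<alpha> + real k + 1) * pochhammer (\<alpha> + real (Suc k) + 1) (n - Suc k)) / fact n"
    unfolding jacobi_coeff_def by (simp add: mult_ac)
  also have "\<dots> = (real n - real k) * (real n + real k + \<alpha> + \<beta> + 1) * jacobi_coeff \<alpha> \<beta> n k"
    unfolding binom poch[symmetric] jacobi_coeff_def pochhammer_Suc
    by (simp add: mult_ac add_ac)
  finally show ?thesis .
next
  case False
  then show ?thesis by (auto simp: jacobi_coeff_def binomial_eq_0)
qed

text \<open>The polynomial is taken in the variable \<open>(x - 1)/2\<close>, in which its coefficients are explicit,
  and over the complex numbers, since it is evaluated off the interval.\<close>
definition jacobi_shifted :: "real \<Rightarrow> real \<Rightarrow> nat \<Rightarrow> complex poly" where
  "jacobi_shifted \<alpha> \<beta> n = (\<Sum>k\<le>n. monom (of_real (jacobi_coeff \<alpha> \<beta> n k)) k)"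

lemma coeff_jacobi_shifted: "coeff (jacobi_shifted \<alpha> \<beta> n) k = of_real (jacobi_coeff \<alpha> \<beta> n k)"
proof (cases "k \<le> n")
  case True
  then show ?thesis
    unfolding jacobi_shifted_def by (simp add: coeff_sum sum.delta if_distrib cong: if_cong)
next
  case False
  then show ?thesis
    unfolding jacobi_shifted_def
    by (simp add: coeff_sum sum.delta if_distrib jacobi_coeff_def binomial_eq_0 cong: if_cong)
qed

lemma poly_jacobi_shifted:
  "poly (jacobi_shifted \<alpha> \<beta> n) y = (\<Sum>k\<le>n. of_real (jacobi_coeff \<alpha> \<beta> n k) * y ^ k)"
  by (simp add: jacobi_shifted_def poly_sum poly_monom)

lemma poly_jacobi_shifted_of_real:
  "poly (jacobi_shifted \<alpha> \<beta> n) (of_real ((x - 1) / 2)) = of_real (jacobi_poly \<alpha> \<beta> n x)"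
  by (simp add: poly_jacobi_shifted jacobi_poly_eq_sum_coeff)

lemma poly_pderiv_jacobi_shifted_real:
  "poly (pderiv (jacobi_shifted \<alpha> \<beta> n)) (of_real t) \<in> \<real>"
proof -
  have "coeff (pderiv (jacobi_shifted \<alpha> \<beta> n)) k \<in> \<real>" for k
    by (simp add: coeff_pderiv coeff_jacobi_shifted)
  then show ?thesis
    unfolding poly_altdef by (intro sum_in_Reals Reals_mult Reals_power) auto
qed

text \<open>Coefficientwise this is the recurrence \<open>jacobi_coeff_Suc\<close>.\<close>
lemma jacobi_shifted_ode:
  fixes \<alpha> \<beta> :: real and n :: nat
  defines "f \<equiv> jacobi_shifted \<alpha> \<beta> n"
  shows "y * (1 + y) * poly (pderiv (pderiv f)) y
       + (of_real (\<alpha> + 1) + of_real (\<alpha> + \<beta> + 2) * y) * poly (pderiv f) y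
       = of_real (real n * (real n + \<alpha> + \<beta> + 1)) * poly f y"
proof -
  have "[:0, 1, 1:] * pderiv (pderiv f) + [:of_real (\<alpha> + 1), of_real (\<alpha> + \<beta> + 2):] * pderiv f
      = smult (of_real (real n * (real n + \<alpha> + \<beta> + 1))) f" (is "?L = ?R")
  proof (rule poly_eqI)
    fix k
    have rec: "of_nat (Suc k) * of_real (\<alpha> + real k + 1) * coeff f (Suc k)
      = of_real ((real n - real k) * (real n + real k + \<alpha> + \<beta> + 1)) * coeff f k"
      using arg_cong[OF jacobi_coeff_Suc[of k \<alpha> \<beta> n], of complex_of_real]
      unfolding f_def coeff_jacobi_shifted of_real_mult by simp
    have "coeff ?L k = of_nat (Suc k) * of_real (\<alpha> + real k + 1) * coeff f (Suc k)
        + of_real (real k * (real k + \<alpha> + \<beta> + 1)) * coeff f k"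
      by (cases k; cases "k - 1")
         (simp_all add: coeff_pderiv coeff_pCons algebra_simps split: nat.splits)
    also have "\<dots> = coeff ?R k"
      unfolding rec by (simp add: algebra_simps)
    finally show "coeff ?L k = coeff ?R k" .
  qed
  from arg_cong[OF this, of "\<lambda>p. poly p y"] show ?thesis
    by (simp add: algebra_simps)
qed

section \<open>An a priori estimate along a ray\<close>

text \<open>The system says that \<open>b = D v\<close> and \<open>D b = 2 M b + r \<kappa> v\<close> with \<open>D = r d/dr\<close>. The combination
  \<open>A = 2 M v - b\<close> has derivative \<open>- \<kappa> v\<close>, so it is constant up to \<open>Q S\<close>, where \<open>S\<close> is the maximum
  of \<open>\<bar>v\<bar>\<close>. The other component \<open>b\<close> grows like \<open>r\<close> to the power \<open>2 M\<close>, hence is controlled by its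
  value at \<open>1\<close>, again up to \<open>Q S\<close>. By the symmetry hypothesis \<open>\<bar>b 1\<bar> = \<bar>A 1\<bar>\<close>, so both components
  are bounded by \<open>\<bar>A 0\<bar> = 2 M \<bar>v 0\<bar>\<close> and a multiple of \<open>Q S\<close>. Since \<open>2 M v = A + b\<close> and
  \<open>3 Q \<le> M\<close>, the terms with \<open>S\<close> are absorbed, and \<open>S \<le> 4 \<bar>v 0\<bar>\<close>.\<close>
lemma ray_estimate:
  fixes v b \<kappa> :: "real \<Rightarrow> complex" and M Q :: real
  assumes contv: "continuous_on {0..1} v" and contb: "continuous_on {0..1} b"
    and dv: "\<And>r. 0 < r \<Longrightarrow> r < 1 \<Longrightarrow> (v has_vector_derivative b r / of_real r) (at r)"
    and db: "\<And>r. 0 < r \<Longrightarrow> r < 1 \<Longrightarrow>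
          (b has_vector_derivative (of_real (2 * M) * b r / of_real r + \<kappa> r * v r)) (at r)"
    and \<kappa>: "\<And>r. 0 < r \<Longrightarrow> r < 1 \<Longrightarrow> norm (\<kappa> r) \<le> Q"
    and b0: "b 0 = 0"
    and sym: "norm (of_real (2 * M) * v 1 - b 1) = norm (b 1)"
    and M: "1 \<le> M" "3 * Q \<le> M" and Q: "0 \<le> Q"
  shows "norm (of_real (2 * M) * v 1 - b 1 - of_real (2 * M) * v 0) \<le> 4 * Q * norm (v 0)"
proof -
  define A where "A = (\<lambda>r. of_real (2 * M) * v r - b r)"
  have contA: "continuous_on {0..1} A"
    unfolding A_def by (intro continuous_intros contv contb)
  have dA: "(A has_vector_derivative - (\<kappa> r * v r)) (at r)" if "0 < r" "r < 1" for r
  proof -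
    have "(A has_vector_derivative of_real (2 * M) * (b r / of_real r)
        - (of_real (2 * M) * b r / of_real r + \<kappa> r * v r)) (at r)"
      unfolding A_def
      by (intro has_vector_derivative_diff has_vector_derivative_mult_right dv db that)
    then show ?thesis by simp
  qed
  obtain m where m: "m \<in> {0..1}" "\<And>r. r \<in> {0..1} \<Longrightarrow> norm (v r) \<le> norm (v m)"
    using continuous_attains_sup[of "{0..1}" "\<lambda>r. norm (v r)"] continuous_on_norm[OF contv] by auto
  define S where "S = norm (v m)"
  have S0: "0 \<le> S" by (simp add: S_def)
  have vS: "norm (\<kappa> r * v r) \<le> Q * S" if "0 < r" "r < 1" for r
    unfolding norm_mult S_def using that by (intro mult_mono \<kappa> m) (auto simp: Q)
  have A_bound: "norm (A r - A 0) \<le> Q * S" if "r \<in> {0..1}" for r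
  proof (cases "r = 0")
    case False
    with that have r: "0 < r" "r \<le> 1" by auto
    have "norm (A r - A 0) \<le> Q * S * r - Q * S * 0"
    proof (rule differentiable_bound_general[OF r(1)])
      show "continuous_on {0..r} A" using contA r by (auto intro: continuous_on_subset)
      show "(A has_vector_derivative - (\<kappa> t * v t)) (at t)" if "0 < t" "t < r" for t
        using that r by (intro dA) auto
      show "((\<lambda>t. Q * S * t) has_vector_derivative Q * S) (at t)" for t
        by (auto intro!: derivative_eq_intros)
      show "norm (- (\<kappa> t * v t)) \<le> Q * S" if "0 < t" "t < r" for t
        using that r vS[of t] by simp
    qed (auto intro!: continuous_intros)
    also have "\<dots> \<le> Q * S" using Q S0 r by (simp add: mult_left_le)
    finally show ?thesis .
  qed (use Q S0 in auto)
  have b_bound: "norm (b r) \<le> norm (b 1) + Q * S" if r: "0 < r" "r < 1" for r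
  proof -
    \<comment> \<open>The integrating factor \<open>t powr (-2 M)\<close> removes the growth of \<open>b\<close>; \<open>\<phi>\<close> is a primitive of
      the bound for the derivative of \<open>g\<close>.\<close>
    define g where "g = (\<lambda>t. of_real (t powr (-2 * M)) * b t)"
    define \<phi> where "\<phi> = (\<lambda>t. - (Q * S / (2 * M - 1)) * t powr (1 - 2 * M))"
    have "norm (g 1 - g r) \<le> \<phi> 1 - \<phi> r"
    proof (rule differentiable_bound_general[OF r(2)])
      show "continuous_on {r..1} g" unfolding g_def using r
        by (intro continuous_intros continuous_on_subset[OF contb]) auto
      show "continuous_on {r..1} \<phi>" unfolding \<phi>_def using r
        by (intro continuous_intros) auto
      fix t assume t: "r < t" "t < 1"
      then have t0: "0 < t" using r by simp
      have pw: "t powr (- 2 * M - 1) = t powr (- 2 * M) / t"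
        using t0 by (simp add: powr_diff)
      have e1: "((\<lambda>t. t powr (- 2 * M)) has_real_derivative (- 2 * M) * t powr (- 2 * M - 1)) (at t)"
        by (rule has_real_derivative_powr[OF t0])
      have e2: "((\<lambda>t. complex_of_real (t powr (- 2 * M))) has_vector_derivative
              complex_of_real ((- 2 * M) * t powr (- 2 * M - 1))) (at t)"
        by (rule has_vector_derivative_of_real[OF e1])
      have "(g has_vector_derivative (of_real (t powr (- 2 * M)) *
          (of_real (2 * M) * b t / of_real t + \<kappa> t * v t)
         + of_real ((- 2 * M) * t powr (- 2 * M - 1)) * b t)) (at t)"
        unfolding g_def
        by (rule has_vector_derivative_mult[OF e2 db[OF t0 t(2)]])
      also have "(of_real (t powr (- 2 * M)) *
          (of_real (2 * M) * b t / of_real t + \<kappa> t * v t)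
         + of_real ((- 2 * M) * t powr (- 2 * M - 1)) * b t)
         = of_real (t powr (- 2 * M)) * (\<kappa> t * v t)"
        unfolding pw by (simp add: field_simps)
      finally show "(g has_vector_derivative of_real (t powr (- 2 * M)) * (\<kappa> t * v t)) (at t)" .
      have "- (Q * S / (2 * M - 1)) * ((1 - 2 * M) * t powr (1 - 2 * M - 1)) = Q * S * t powr (- 2 * M)"
        using M by (simp add: divide_simps) (simp add: algebra_simps)
      with DERIV_cmult[OF has_real_derivative_powr[OF t0], of "- (Q * S / (2 * M - 1))" "1 - 2 * M"]
      have "(\<phi> has_real_derivative Q * S * t powr (- 2 * M)) (at t)"
        unfolding \<phi>_def by metis
      then show "(\<phi> has_vector_derivative Q * S * t powr (- 2 * M)) (at t)"
        by (simp add: has_real_derivative_iff_has_vector_derivative)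
      show "norm (of_real (t powr (- 2 * M)) * (\<kappa> t * v t)) \<le> Q * S * t powr (- 2 * M)"
        using vS[OF t0 t(2)] unfolding norm_mult[of "of_real _"]
        by (simp add: mult.commute[of "Q * S"] mult_left_mono)
    qed
    also have "\<dots> \<le> Q * S / (2 * M - 1) * r powr (1 - 2 * M)"
      unfolding \<phi>_def using M Q S0 by simp
    finally have "norm (g r) \<le> norm (b 1) + Q * S / (2 * M - 1) * r powr (1 - 2 * M)"
      using norm_triangle_ineq2[of "g r" "g 1"] by (simp add: g_def norm_minus_commute)
    then have "r powr (2 * M) * norm (g r)
       \<le> r powr (2 * M) * norm (b 1) + r powr (2 * M) * (Q * S / (2 * M - 1) * r powr (1 - 2 * M))"
      by (metis distrib_left mult_left_mono powr_ge_zero)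
    moreover have "r powr (2 * M) * norm (g r) = norm (b r)"
      unfolding g_def norm_mult norm_of_real using r by (simp add: powr_minus field_simps)
    moreover have "r powr (2 * M) * (Q * S / (2 * M - 1) * r powr (1 - 2 * M)) = Q * S / (2 * M - 1) * r"
    proof -
      have "r powr (2 * M) * r powr (1 - 2 * M) = r" using r by (simp flip: powr_add)
      then show ?thesis by (metis mult.left_commute)
    qed
    moreover have "r powr (2 * M) \<le> 1" using r M by (intro powr_le1) auto
    then have "r powr (2 * M) * norm (b 1) \<le> norm (b 1)" by (simp add: mult_left_le_one_le)
    moreover have "Q * S / (2 * M - 1) * r \<le> Q * S"
    proof -
      have "Q * S * r \<le> Q * S * (2 * M - 1)" using M r Q S0 by (intro mult_left_mono) auto
      then show ?thesis using M by (simp add: field_simps)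
    qed
    ultimately show ?thesis by linarith
  qed
  have b_bound': "norm (b m) \<le> norm (b 1) + Q * S"
    using b_bound[of m] m(1) b0 Q S0 by (cases "m = 0"; cases "m = 1") auto
  have A1: "norm (A 1) = norm (b 1)" using sym by (simp add: A_def)
  have tri: "norm (A m) \<le> norm (A 0) + Q * S" "norm (A 1) \<le> norm (A 0) + Q * S"
    using A_bound[OF m(1)] A_bound[of 1] norm_triangle_ineq2[of "A m" "A 0"]
      norm_triangle_ineq2[of "A 1" "A 0"] by auto
  have A0: "norm (A 0) = 2 * M * norm (v 0)" using b0 M by (simp add: A_def norm_mult)
  have "2 * M * S = norm (A m + b m)"
    using M by (simp add: A_def S_def norm_mult)
  also have "\<dots> \<le> 2 * norm (A 0) + 3 * Q * S"
    using norm_triangle_ineq[of "A m" "b m"] b_bound' tri A1 by linarith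
  finally have "2 * M * S \<le> 4 * M * norm (v 0) + M * S"
    using mult_right_mono[OF M(2) S0] A0 by linarith
  then have "M * S \<le> M * (4 * norm (v 0))" by (simp add: algebra_simps)
  then have "S \<le> 4 * norm (v 0)" using M by simp
  then have "Q * S \<le> Q * (4 * norm (v 0))" by (rule mult_left_mono[OF _ Q])
  then show ?thesis using A_bound[of 1] b0 by (simp add: A_def)
qed

section \<open>The Jacobi equation in Liouville-Green form\<close>

text \<open>The polynomial \<open>z\<^sup>n P\<^sub>n((z + 1/z)/2)\<close>, written out because of its value at \<open>z = 0\<close>; note that
  \<open>(x - 1)/2 = (1 - z)\<^sup>2 / (4 z)\<close> for \<open>x = (z + 1/z)/2\<close>.\<close>
definition jacobi_disc :: "real \<Rightarrow> real \<Rightarrow> nat \<Rightarrow> complex poly" where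
  "jacobi_disc \<alpha> \<beta> n =
     (\<Sum>k\<le>n. smult (of_real (jacobi_coeff \<alpha> \<beta> n k) / 4 ^ k) ([:1, -1:] ^ (2 * k) * monom 1 (n - k)))"

lemma poly_jacobi_disc_0:
  "poly (jacobi_disc \<alpha> \<beta> n) 0 = of_real (jacobi_coeff \<alpha> \<beta> n n / 4 ^ n)"
proof -
  have "poly (jacobi_disc \<alpha> \<beta> n) 0
     = (\<Sum>k\<le>n. if k = n then of_real (jacobi_coeff \<alpha> \<beta> n k) / 4 ^ k else 0)"
    unfolding jacobi_disc_def poly_sum
    by (intro sum.cong) (auto simp: poly_monom power_0_left)
  then show ?thesis by (simp add: sum.delta)
qed

lemma poly_jacobi_disc:
  assumes "z \<noteq> 0"
  shows "poly (jacobi_disc \<alpha> \<beta> n) z = z ^ n * poly (jacobi_shifted \<alpha> \<beta> n) ((1 - z)\<^sup>2 / (4 * z))"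
  unfolding jacobi_disc_def poly_sum poly_jacobi_shifted sum_distrib_left
proof (intro sum.cong refl)
  fix k assume "k \<in> {..n}"
  then have "z ^ n = z ^ (n - k) * z ^ k" by (simp flip: power_add)
  then show "poly (smult (of_real (jacobi_coeff \<alpha> \<beta> n k) / 4 ^ k) ([:1, - 1:] ^ (2 * k) * monom 1 (n - k))) z
    = z ^ n * (of_real (jacobi_coeff \<alpha> \<beta> n k) * ((1 - z)\<^sup>2 / (4 * z)) ^ k)"
    using assms by (simp add: poly_monom power_mult power_divide power_mult_distrib)
qed

text \<open>The factor \<open>(1 - z)\<^sup>a (1 + z)\<^sup>b\<close>, with principal branches, that turns the coefficient of
  \<open>D v\<close> into the constant \<open>2 M\<close>.\<close>
definition lg_weight :: "real \<Rightarrow> real \<Rightarrow> complex \<Rightarrow> complex" where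
  "lg_weight a b z = exp (of_real a * Ln (1 - z) + of_real b * Ln (1 + z))"

definition lg_weight_dlog :: "real \<Rightarrow> real \<Rightarrow> complex \<Rightarrow> complex" where
  "lg_weight_dlog a b z = of_real b / (1 + z) - of_real a / (1 - z)"

text \<open>This is \<open>q(z) / z\<close> in \<open>D\<^sup>2 v - 2 M D v = q v\<close>; it is regular at \<open>z = 0\<close>.\<close>
definition lg_potential :: "real \<Rightarrow> real \<Rightarrow> complex \<Rightarrow> complex" where
  "lg_potential a b z = of_real (a\<^sup>2 - a) / (1 - z)\<^sup>2 - of_real (b\<^sup>2 - b) / (1 + z)\<^sup>2"

definition lg_fun :: "real \<Rightarrow> real \<Rightarrow> nat \<Rightarrow> complex \<Rightarrow> complex" where
  "lg_fun \<alpha> \<beta> n z = poly (jacobi_disc \<alpha> \<beta> n) z * lg_weight (\<alpha> + 1/2) (\<beta> + 1/2) z"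

text \<open>The derivative \<open>dv/dz\<close> as an explicit expression, which makes \<open>D v = z dv/dz\<close> continuous up to
  \<open>z = 0\<close>.\<close>
definition lg_deriv :: "real \<Rightarrow> real \<Rightarrow> nat \<Rightarrow> complex \<Rightarrow> complex" where
  "lg_deriv \<alpha> \<beta> n z = (poly (pderiv (jacobi_disc \<alpha> \<beta> n)) z
      + poly (jacobi_disc \<alpha> \<beta> n) z * lg_weight_dlog (\<alpha> + 1/2) (\<beta> + 1/2) z)
      * lg_weight (\<alpha> + 1/2) (\<beta> + 1/2) z"

definition slit_domain :: "complex set" where
  "slit_domain = {z. 1 - z \<notin> \<real>\<^sub>\<le>\<^sub>0 \<and> 1 + z \<notin> \<real>\<^sub>\<le>\<^sub>0}"

lemma slit_domain_nonzero: "z \<in> slit_domain \<Longrightarrow> 1 - z \<noteq> 0 \<and> 1 + z \<noteq> 0"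
  unfolding slit_domain_def by (metis (mono_tags) mem_Collect_eq nonpos_Reals_zero_I)

lemma lg_weight_deriv:
  assumes "z \<in> slit_domain"
  shows "(lg_weight a b has_field_derivative lg_weight_dlog a b z * lg_weight a b z) (at z)"
  using assms slit_domain_nonzero[OF assms]
  unfolding lg_weight_def lg_weight_dlog_def slit_domain_def
  by (auto intro!: derivative_eq_intros simp: field_simps)

lemma lg_fun_deriv:
  assumes "z \<in> slit_domain"
  shows "(lg_fun \<alpha> \<beta> n has_field_derivative lg_deriv \<alpha> \<beta> n z) (at z)"
  unfolding lg_fun_def lg_deriv_def
  by (rule derivative_eq_intros poly_DERIV lg_weight_deriv[OF assms] refl)+ (simp add: algebra_simps)

text \<open>The derivative of \<open>z\<^sup>n f(y(z))\<close> times the weight, where \<open>f\<close> is the Jacobi polynomial. In this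
  form the Jacobi equation for \<open>f\<close> can be used in the second derivative.\<close>
lemma lg_deriv_factorised:
  fixes \<alpha> \<beta> :: real and n :: nat and z :: complex
  defines "y \<equiv> (1 - z)\<^sup>2 / (4 * z)" and "f \<equiv> jacobi_shifted \<alpha> \<beta> n"
    and "a \<equiv> \<alpha> + 1/2" and "b \<equiv> \<beta> + 1/2"
  assumes z: "z \<noteq> 0" "z \<in> slit_domain"
  shows "z * lg_deriv \<alpha> \<beta> n z = z ^ n * lg_weight a b z *
      (poly (pderiv f) y * (z\<^sup>2 - 1) / (4 * z) + (of_nat n + z * lg_weight_dlog a b z) * poly f y)"
proof -
  have y': "((\<lambda>z. (1 - z)\<^sup>2 / (4 * z)) has_field_derivative (z\<^sup>2 - 1) / (4 * z\<^sup>2)) (at z)"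
    using z by (auto intro!: derivative_eq_intros simp: field_simps power2_eq_square)
  have "((\<lambda>z. z ^ n * poly f ((1 - z)\<^sup>2 / (4 * z))) has_field_derivative
      of_nat n * z ^ (n - 1) * poly f y + poly (pderiv f) y * ((z\<^sup>2 - 1) / (4 * z\<^sup>2)) * z ^ n) (at z)"
    unfolding y_def
    by (rule derivative_eq_intros DERIV_chain2[OF poly_DERIV y'] refl)+ simp
  moreover have "\<forall>\<^sub>F w in nhds z. poly (jacobi_disc \<alpha> \<beta> n) w = w ^ n * poly f ((1 - w)\<^sup>2 / (4 * w))"
    using t1_space_nhds[OF z(1)] by eventually_elim (simp add: poly_jacobi_disc f_def)
  ultimately have d: "(poly (jacobi_disc \<alpha> \<beta> n) has_field_derivative
      of_nat n * z ^ (n - 1) * poly f y + poly (pderiv f) y * ((z\<^sup>2 - 1) / (4 * z\<^sup>2)) * z ^ n) (at z)"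
    by (subst DERIV_cong_ev[OF refl _ refl])
  from DERIV_unique[OF poly_DERIV d]
  have Q': "z * poly (pderiv (jacobi_disc \<alpha> \<beta> n)) z
      = z ^ n * (of_nat n * poly f y + poly (pderiv f) y * (z\<^sup>2 - 1) / (4 * z))"
    using z by (cases n) (simp_all add: field_simps power2_eq_square)
  have "z * lg_deriv \<alpha> \<beta> n z = (z * poly (pderiv (jacobi_disc \<alpha> \<beta> n)) z
      + poly (jacobi_disc \<alpha> \<beta> n) z * (z * lg_weight_dlog a b z)) * lg_weight a b z"
    unfolding lg_deriv_def a_def b_def by (simp add: algebra_simps)
  also have "\<dots> = z ^ n * lg_weight a b z *
      (poly (pderiv f) y * (z\<^sup>2 - 1) / (4 * z) + (of_nat n + z * lg_weight_dlog a b z) * poly f y)"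
    unfolding Q' unfolding poly_jacobi_disc[OF z(1)] f_def y_def by (simp add: algebra_simps)
  finally show ?thesis .
qed

text \<open>The change of variable and of unknown, at one point: \<open>f0\<close>, \<open>f1\<close>, \<open>f2\<close> stand for the values of
  \<open>f\<close>, \<open>f'\<close>, \<open>f''\<close> at \<open>y\<close>, and \<open>p\<close> for the logarithmic derivative of the weight. The choice of the
  exponents \<open>a\<close>, \<open>b\<close> makes the coefficients of \<open>f1\<close> agree (\<open>c1\<close>); the coefficients of \<open>f0\<close> define
  the potential (\<open>c0\<close>).\<close>
lemma liouville_green_algebra:
  fixes z a b nn f0 f1 f2 :: complex
  assumes z: "z \<noteq> 0" "1 - z \<noteq> 0" "1 + z \<noteq> 0"
    and y: "y = (1 - z)\<^sup>2 / (4 * z)"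
    and ode: "y * (1 + y) * f2 + (a + 1/2 + (a + b + 1) * y) * f1 = nn * (nn + a + b) * f0"
    and p: "p = b / (1 + z) - a / (1 - z)"
  shows "(nn / z + p) * (f1 * (z\<^sup>2 - 1) / (4 * z) + (nn + z * p) * f0)
      + (f2 * ((z\<^sup>2 - 1) / (4 * z\<^sup>2)) * (z\<^sup>2 - 1) / (4 * z) + f1 * ((z\<^sup>2 + 1) / (4 * z\<^sup>2))
         + (nn + z * p) * (f1 * ((z\<^sup>2 - 1) / (4 * z\<^sup>2)))
         + (p + z * (- b / (1 + z)\<^sup>2 - a / (1 - z)\<^sup>2)) * f0)
    = (2 * nn + a + b) / z * (f1 * (z\<^sup>2 - 1) / (4 * z) + (nn + z * p) * f0)
      + ((a\<^sup>2 - a) / (1 - z)\<^sup>2 - (b\<^sup>2 - b) / (1 + z)\<^sup>2) * f0"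
proof -
  \<comment> \<open>With \<open>D = z d/dz\<close> this is \<open>(D y)\<^sup>2 = y (1 + y)\<close>, which turns the \<open>f2\<close> term into the one of the
    Jacobi equation.\<close>
  have yy: "y * (1 + y) = (z\<^sup>2 - 1)\<^sup>2 / (16 * z\<^sup>2)"
    unfolding y using z by (simp add: field_simps power2_eq_square)
  have "f2 * ((z\<^sup>2 - 1) / (4 * z\<^sup>2)) * (z\<^sup>2 - 1) / (4 * z) = y * (1 + y) * f2 / z"
    unfolding yy using z by (simp add: field_simps power2_eq_square)
  also have "\<dots> = (nn * (nn + a + b) * f0 - (a + 1/2 + (a + b + 1) * y) * f1) / z"
    using ode by (simp add: algebra_simps)
  finally have f2: "f2 * ((z\<^sup>2 - 1) / (4 * z\<^sup>2)) * (z\<^sup>2 - 1) / (4 * z)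
    = (nn * (nn + a + b) * f0 - (a + 1/2 + (a + b + 1) * y) * f1) / z" .
  have c1: "(nn / z + p) * ((z\<^sup>2 - 1) / (4 * z)) + (z\<^sup>2 + 1) / (4 * z\<^sup>2)
      + (nn + z * p) * ((z\<^sup>2 - 1) / (4 * z\<^sup>2)) - (a + 1/2 + (a + b + 1) * y) / z
      = (2 * nn + a + b) / z * ((z\<^sup>2 - 1) / (4 * z))"
    unfolding p y using z by (simp add: divide_simps) algebra
  have c0: "(nn / z + p) * (nn + z * p) + nn * (nn + a + b) / z
       + (p + z * (- b / (1 + z)\<^sup>2 - a / (1 - z)\<^sup>2))
      = (2 * nn + a + b) / z * (nn + z * p) + ((a\<^sup>2 - a) / (1 - z)\<^sup>2 - (b\<^sup>2 - b) / (1 + z)\<^sup>2)"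
    unfolding p using z by (simp add: divide_simps) algebra
  have "(nn / z + p) * (f1 * (z\<^sup>2 - 1) / (4 * z) + (nn + z * p) * f0)
      + (f2 * ((z\<^sup>2 - 1) / (4 * z\<^sup>2)) * (z\<^sup>2 - 1) / (4 * z) + f1 * ((z\<^sup>2 + 1) / (4 * z\<^sup>2))
         + (nn + z * p) * (f1 * ((z\<^sup>2 - 1) / (4 * z\<^sup>2)))
         + (p + z * (- b / (1 + z)\<^sup>2 - a / (1 - z)\<^sup>2)) * f0)
    = ((nn / z + p) * ((z\<^sup>2 - 1) / (4 * z)) + (z\<^sup>2 + 1) / (4 * z\<^sup>2)
      + (nn + z * p) * ((z\<^sup>2 - 1) / (4 * z\<^sup>2)) - (a + 1/2 + (a + b + 1) * y) / z) * f1
     + ((nn / z + p) * (nn + z * p) + nn * (nn + a + b) / z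
       + (p + z * (- b / (1 + z)\<^sup>2 - a / (1 - z)\<^sup>2))) * f0"
    unfolding f2 by (simp add: ring_distribs diff_divide_distrib add_divide_distrib mult_ac)
  also have "\<dots> = (2 * nn + a + b) / z * ((z\<^sup>2 - 1) / (4 * z)) * f1
      + ((2 * nn + a + b) / z * (nn + z * p) + ((a\<^sup>2 - a) / (1 - z)\<^sup>2 - (b\<^sup>2 - b) / (1 + z)\<^sup>2)) * f0"
    unfolding c1 c0 ..
  also have "C * r * f1 + (C * m + q) * f0 = C * (f1 * r + m * f0) + q * f0" for C r m q :: complex
    by (simp add: algebra_simps)
  finally show ?thesis by simp
qed

lemma slit_domain_open: "open slit_domain"
proof -
  have "slit_domain = (\<lambda>z. 1 - z) -` (- \<real>\<^sub>\<le>\<^sub>0) \<inter> (\<lambda>z. 1 + z) -` (- \<real>\<^sub>\<le>\<^sub>0)"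
    by (auto simp: slit_domain_def)
  also have "open \<dots>"
    by (intro open_Int open_vimage open_Compl closed_nonpos_Reals_complex continuous_intros)
  finally show ?thesis .
qed

text \<open>The equation \<open>D\<^sup>2 v = 2 M D v + q v\<close>, divided by \<open>z\<close>.\<close>
lemma lg_deriv_deriv:
  fixes \<alpha> \<beta> :: real and n :: nat
  assumes z: "z \<noteq> 0" "z \<in> slit_domain"
  shows "((\<lambda>z. z * lg_deriv \<alpha> \<beta> n z) has_field_derivative
      of_real (2 * real n + \<alpha> + \<beta> + 1) * lg_deriv \<alpha> \<beta> n z
      + lg_potential (\<alpha> + 1/2) (\<beta> + 1/2) z * lg_fun \<alpha> \<beta> n z) (at z)"
proof -
  define a where "a = \<alpha> + 1/2"
  define b where "b = \<beta> + 1/2"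
  define f where "f = jacobi_shifted \<alpha> \<beta> n"
  define y where "y = (\<lambda>z::complex. (1 - z)\<^sup>2 / (4 * z))"
  define p where "p = lg_weight_dlog a b"
  define G where "G = (\<lambda>z. z ^ n * lg_weight a b z)"
  define E where "E = (\<lambda>z. poly (pderiv f) (y z) * (z\<^sup>2 - 1) / (4 * z) + (of_nat n + z * p z) * poly f (y z))"
  have nz: "1 - z \<noteq> 0" "1 + z \<noteq> 0" using slit_domain_nonzero[OF z(2)] by auto
  have y': "(y has_field_derivative (z\<^sup>2 - 1) / (4 * z\<^sup>2)) (at z)"
    unfolding y_def using z by (auto intro!: derivative_eq_intros simp: field_simps power2_eq_square)
  have p': "(p has_field_derivative (- of_real b / (1 + z)\<^sup>2 - of_real a / (1 - z)\<^sup>2)) (at z)"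
    unfolding p_def lg_weight_dlog_def using nz
    by (auto intro!: derivative_eq_intros simp: power2_eq_square)
  have r': "((\<lambda>z. (z\<^sup>2 - 1) / (4 * z)) has_field_derivative (z\<^sup>2 + 1) / (4 * z\<^sup>2)) (at z)"
    using z by (auto intro!: derivative_eq_intros simp: field_simps power2_eq_square)
  have G': "(G has_field_derivative (of_nat n / z + p z) * G z) (at z)"
    unfolding G_def p_def
    by (rule derivative_eq_intros lg_weight_deriv[OF z(2)] refl)+
       (use z in \<open>cases n; simp add: field_simps\<close>)
  have f': "((\<lambda>z. poly f (y z)) has_field_derivative poly (pderiv f) (y z) * ((z\<^sup>2 - 1) / (4 * z\<^sup>2))) (at z)"
    by (rule DERIV_chain2[OF poly_DERIV y'])
  have f'': "((\<lambda>z. poly (pderiv f) (y z)) has_field_derivative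
      poly (pderiv (pderiv f)) (y z) * ((z\<^sup>2 - 1) / (4 * z\<^sup>2))) (at z)"
    by (rule DERIV_chain2[OF poly_DERIV y'])
  define E' where "E' = poly (pderiv (pderiv f)) (y z) * ((z\<^sup>2 - 1) / (4 * z\<^sup>2)) * (z\<^sup>2 - 1) / (4 * z)
      + poly (pderiv f) (y z) * ((z\<^sup>2 + 1) / (4 * z\<^sup>2))
      + (of_nat n + z * p z) * (poly (pderiv f) (y z) * ((z\<^sup>2 - 1) / (4 * z\<^sup>2)))
      + (p z + z * (- of_real b / (1 + z)\<^sup>2 - of_real a / (1 - z)\<^sup>2)) * poly f (y z)"
  have m': "((\<lambda>z. of_nat n + z * p z) has_field_derivative
      p z + z * (- of_real b / (1 + z)\<^sup>2 - of_real a / (1 - z)\<^sup>2)) (at z)"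
    by (rule derivative_eq_intros p' refl)+ simp
  have "E = (\<lambda>z. poly (pderiv f) (y z) * ((z\<^sup>2 - 1) / (4 * z)) + (of_nat n + z * p z) * poly f (y z))"
    by (simp add: E_def fun_eq_iff)
  then have E': "(E has_field_derivative E') (at z)"
    using DERIV_add[OF DERIV_mult'[OF f'' r'] DERIV_mult'[OF m' f']]
    by (simp add: E'_def add_ac mult.commute)
  have GE: "((\<lambda>z. G z * E z) has_field_derivative (of_nat n / z + p z) * G z * E z + E' * G z) (at z)"
    by (rule DERIV_mult[OF G' E'])
  have D: "w * lg_deriv \<alpha> \<beta> n w = G w * E w" if "w \<noteq> 0" "w \<in> slit_domain" for w
    using lg_deriv_factorised[OF that, of \<alpha> \<beta> n] unfolding G_def E_def p_def a_def b_def f_def y_def .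
  have "\<forall>\<^sub>F w in nhds z. w * lg_deriv \<alpha> \<beta> n w = G w * E w"
    using t1_space_nhds[OF z(1)] eventually_nhds_in_open[OF slit_domain_open z(2)]
    by eventually_elim (rule D)
  with GE have deriv: "((\<lambda>z. z * lg_deriv \<alpha> \<beta> n z) has_field_derivative
      (of_nat n / z + p z) * G z * E z + E' * G z) (at z)"
    by (subst DERIV_cong_ev[OF refl _ refl])
  have ode: "y z * (1 + y z) * poly (pderiv (pderiv f)) (y z)
     + (of_real a + 1/2 + (of_real a + of_real b + 1) * y z) * poly (pderiv f) (y z)
      = of_nat n * (of_nat n + of_real a + of_real b) * poly f (y z)"
    using jacobi_shifted_ode[of "y z" \<alpha> \<beta> n] unfolding f_def a_def b_def by (simp add: algebra_simps)
  have "(of_nat n / z + p z) * G z * E z + E' * G z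
    = G z * ((of_nat n / z + p z) * E z + E')" by (simp add: algebra_simps)
  also have "(of_nat n / z + p z) * E z + E' =
      (2 * of_nat n + of_real a + of_real b) / z * E z + lg_potential a b z * poly f (y z)"
    unfolding E_def E'_def lg_potential_def
    using liouville_green_algebra[OF z(1) nz fun_cong[OF y_def] ode
        fun_cong[OF p_def[unfolded lg_weight_dlog_def[abs_def]]]]
    by simp
  also have "G z * \<dots> = (2 * of_nat n + of_real a + of_real b) * ((G z * E z) / z)
      + lg_potential a b z * (G z * poly f (y z))"
    by (simp add: algebra_simps add_divide_distrib)
  also have "(G z * E z) / z = lg_deriv \<alpha> \<beta> n z"
    using D[OF z] z(1) by (simp add: field_simps)
  also have "G z * poly f (y z) = lg_fun \<alpha> \<beta> n z"
    unfolding lg_fun_def poly_jacobi_disc[OF z(1)] G_def f_def a_def b_def y_def by simp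
  finally show ?thesis
    using deriv by (simp add: a_def b_def add_ac)
qed

section \<open>Darboux's formula\<close>

definition darboux_weight :: "real \<Rightarrow> real \<Rightarrow> real \<Rightarrow> real" where
  "darboux_weight \<alpha> \<beta> \<theta> = (2 * sin (\<theta> / 2)) powr (\<alpha> + 1/2) * (2 * cos (\<theta> / 2)) powr (\<beta> + 1/2)"

definition darboux_phase :: "real \<Rightarrow> real \<Rightarrow> real \<Rightarrow> nat \<Rightarrow> real" where
  "darboux_phase \<alpha> \<beta> \<theta> n = (real n + (\<alpha> + \<beta> + 1) / 2) * \<theta> - (\<alpha> + 1/2) * pi / 2"

text \<open>The coefficient of \<open>x\<^sup>n\<close> in the Jacobi polynomial, divided by \<open>2\<^sup>n\<close>.\<close>
definition jacobi_lead :: "real \<Rightarrow> real \<Rightarrow> nat \<Rightarrow> real" where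
  "jacobi_lead \<alpha> \<beta> n = pochhammer (real n + \<alpha> + \<beta> + 1) n / (fact n * 4 ^ n)"

lemma half_angle_pos:
  assumes "0 < \<theta>" "\<theta> < pi"
  shows "0 < sin (\<theta> / 2)" "0 < cos (\<theta> / 2)"
  using assms by (auto intro!: sin_gt_zero cos_gt_zero)

text \<open>Half-angle formulas: \<open>1 - e\<^sup>-\<^sup>i\<^sup>\<theta> = 2 sin (\<theta>/2) e\<^sup>i\<^sup>(\<^sup>\<pi>\<^sup>-\<^sup>\<theta>\<^sup>)\<^sup>/\<^sup>2\<close> and
  \<open>1 + e\<^sup>-\<^sup>i\<^sup>\<theta> = 2 cos (\<theta>/2) e\<^sup>-\<^sup>i\<^sup>\<theta>\<^sup>/\<^sup>2\<close>, with arguments in the principal range.\<close>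
lemma lg_weight_cis:
  assumes \<theta>: "0 < \<theta>" "\<theta> < pi"
  shows "lg_weight (\<alpha> + 1/2) (\<beta> + 1/2) (cis (- \<theta>)) =
     of_real (darboux_weight \<alpha> \<beta> \<theta>) * cis ((\<alpha> + 1/2) * pi / 2 - (\<alpha> + \<beta> + 1) / 2 * \<theta>)"
proof -
  define t where "t = \<theta> / 2"
  have t: "\<theta> = 2 * t" "0 < t" "t < pi / 2" using \<theta> by (auto simp: t_def)
  have pos: "0 < 2 * sin t" "0 < 2 * cos t" using half_angle_pos[OF \<theta>] by (auto simp: t_def)
  have L1: "Ln (1 - cis (- \<theta>)) = of_real (ln (2 * sin t)) + \<i> * of_real (pi / 2 - t)"
  proof (rule Ln_unique)
    have "exp (of_real (ln (2 * sin t)) + \<i> * of_real (pi / 2 - t)) = of_real (2 * sin t) * cis (pi / 2 - t)"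
      using pos by (simp only: exp_add exp_of_real exp_ln cis_conv_exp)
    also have "\<dots> = 1 - cis (- \<theta>)"
      unfolding t(1) by (rule complex_eqI)
        (simp_all add: cos_diff sin_diff sin_double cos_double_sin power2_eq_square)
    finally show "exp (of_real (ln (2 * sin t)) + \<i> * of_real (pi / 2 - t)) = 1 - cis (- \<theta>)" .
  qed (use t in auto)
  have L2: "Ln (1 + cis (- \<theta>)) = of_real (ln (2 * cos t)) + \<i> * of_real (- t)"
  proof (rule Ln_unique)
    have "exp (of_real (ln (2 * cos t)) + \<i> * of_real (- t)) = of_real (2 * cos t) * cis (- t)"
      using pos by (simp only: exp_add exp_of_real exp_ln cis_conv_exp)
    also have "\<dots> = 1 + cis (- \<theta>)"
      unfolding t(1) by (rule complex_eqI)
        (simp_all add: sin_double cos_double_cos power2_eq_square)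
    finally show "exp (of_real (ln (2 * cos t)) + \<i> * of_real (- t)) = 1 + cis (- \<theta>)" .
  qed (use t in auto)
  have "lg_weight (\<alpha> + 1/2) (\<beta> + 1/2) (cis (- \<theta>)) =
     exp (of_real ((\<alpha> + 1/2) * ln (2 * sin t)) + of_real ((\<beta> + 1/2) * ln (2 * cos t))
       + \<i> * of_real ((\<alpha> + 1/2) * pi / 2 - (\<alpha> + \<beta> + 1) / 2 * \<theta>))"
    unfolding lg_weight_def L1 L2
    by (intro arg_cong[of _ _ exp]) (simp add: t(1) algebra_simps)
  also have "\<dots> = of_real (exp ((\<alpha> + 1/2) * ln (2 * sin t)) * exp ((\<beta> + 1/2) * ln (2 * cos t)))
      * cis ((\<alpha> + 1/2) * pi / 2 - (\<alpha> + \<beta> + 1) / 2 * \<theta>)"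
    by (simp only: exp_add exp_of_real cis_conv_exp of_real_mult[of "exp _"])
  also have "exp ((\<alpha> + 1/2) * ln (2 * sin t)) * exp ((\<beta> + 1/2) * ln (2 * cos t)) = darboux_weight \<alpha> \<beta> \<theta>"
    using pos unfolding darboux_weight_def t_def[symmetric] by (simp add: powr_def)
  finally show ?thesis .
qed

lemma cis_ne:
  assumes "0 < \<theta>" "\<theta> < pi"
  shows "1 - cis (- \<theta>) \<noteq> 0" "1 + cis (- \<theta>) \<noteq> 0"
  using sin_gt_zero[OF assms] by (auto simp: complex_eq_iff)

lemma ray_in_slit_domain:
  assumes "0 < \<theta>" "\<theta> < pi"
  shows "of_real r * cis (- \<theta>) \<in> slit_domain"
  using sin_gt_zero[OF assms]
  by (auto simp: slit_domain_def complex_nonpos_Reals_iff)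

text \<open>The distance of \<open>1\<close> and of \<open>-1\<close> from the line through \<open>0\<close> and \<open>e\<^sup>-\<^sup>i\<^sup>\<theta>\<close> is \<open>sin \<theta>\<close>.\<close>
lemma norm_ray_ge:
  assumes "0 < \<theta>" "\<theta> < pi"
  shows "sin \<theta> \<le> norm (1 - of_real r * cis (- \<theta>))" "sin \<theta> \<le> norm (1 + of_real r * cis (- \<theta>))"
proof -
  have e: "1 + of_real s * cis (- \<theta>) = cis (- \<theta>) * (cis \<theta> + of_real s)" for s
    by (simp add: algebra_simps cis_mult)
  have "sin \<theta> \<le> norm (1 + of_real s * cis (- \<theta>))" for s
    using abs_Im_le_cmod[of "cis \<theta> + of_real s"] unfolding e norm_mult by simp
  from this[of r] this[of "- r"]
  show "sin \<theta> \<le> norm (1 - of_real r * cis (- \<theta>))" "sin \<theta> \<le> norm (1 + of_real r * cis (- \<theta>))"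
    by simp_all
qed

lemma jacobi_arg_cis: "(1 - cis (- \<theta>))\<^sup>2 / (4 * cis (- \<theta>)) = of_real ((cos \<theta> - 1) / 2)"
proof -
  have "(1 - cis (- \<theta>))\<^sup>2 = 4 * cis (- \<theta>) * of_real ((cos \<theta> - 1) / 2)"
    by (rule complex_eqI)
       (simp_all add: power2_eq_square algebra_simps sin_squared_eq[unfolded power2_eq_square])
  then show ?thesis by (simp only:) simp
qed

lemma darboux_phase_cis:
  "cis (- \<theta>) ^ n * cis ((\<alpha> + 1/2) * pi / 2 - (\<alpha> + \<beta> + 1) / 2 * \<theta>)
      = cis (- darboux_phase \<alpha> \<beta> \<theta> n)"
proof -
  have "real n * (- \<theta>) + ((\<alpha> + 1/2) * pi / 2 - (\<alpha> + \<beta> + 1) / 2 * \<theta>) = - darboux_phase \<alpha> \<beta> \<theta> n"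
    unfolding darboux_phase_def by (simp add: algebra_simps)
  then show ?thesis
    by (simp only: Complex.DeMoivre cis_mult)
qed

lemma lg_fun_cis:
  assumes "0 < \<theta>" "\<theta> < pi"
  shows "lg_fun \<alpha> \<beta> n (cis (- \<theta>)) = cis (- darboux_phase \<alpha> \<beta> \<theta> n)
    * of_real (darboux_weight \<alpha> \<beta> \<theta> * jacobi_poly \<alpha> \<beta> n (cos \<theta>))"
  unfolding lg_fun_def poly_jacobi_disc[OF cis_neq_zero] jacobi_arg_cis poly_jacobi_shifted_of_real
      lg_weight_cis[OF assms] darboux_phase_cis[symmetric]
  by (simp add: mult_ac)

text \<open>On the unit circle \<open>v\<close> is a real function times a phase, and \<open>D\<close> is \<open>i d/d\<theta>\<close>. After removal of
  the phase, the derivative of the real function contributes to the imaginary part of \<open>D v\<close> only,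
  and the derivative of the phase gives the real part \<open>M v\<close>. This makes \<open>\<bar>2 M v - D v\<bar> = \<bar>D v\<bar>\<close>,
  the symmetry needed in \<open>ray_estimate\<close>.\<close>
lemma lg_deriv_cis:
  assumes \<theta>: "0 < \<theta>" "\<theta> < pi"
  obtains R where "cis (- \<theta>) * lg_deriv \<alpha> \<beta> n (cis (- \<theta>)) = cis (- darboux_phase \<alpha> \<beta> \<theta> n)
    * (of_real ((real n + (\<alpha> + \<beta> + 1) / 2) * (darboux_weight \<alpha> \<beta> \<theta> * jacobi_poly \<alpha> \<beta> n (cos \<theta>)))
       + \<i> * of_real R)"
proof -
  define w where "w = cis (- \<theta>)"
  define a where "a = \<alpha> + 1/2"
  define b where "b = \<beta> + 1/2"
  define P where "P = jacobi_poly \<alpha> \<beta> n (cos \<theta>)"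
  have w: "w \<noteq> 0" "w \<in> slit_domain" "1 - w \<noteq> 0" "1 + w \<noteq> 0"
    using ray_in_slit_domain[OF \<theta>, of 1] cis_ne[OF \<theta>] by (auto simp: w_def)
  obtain f1 where f1: "poly (pderiv (jacobi_shifted \<alpha> \<beta> n)) (of_real ((cos \<theta> - 1) / 2)) = of_real f1"
    using poly_pderiv_jacobi_shifted_real by (metis Reals_cases)
  have Dy: "(w\<^sup>2 - 1) / (4 * w) = \<i> * of_real (- sin \<theta> / 2)"
  proof -
    have "w\<^sup>2 - 1 = (4 * w) * (\<i> * of_real (- sin \<theta> / 2))"
      unfolding w_def by (rule complex_eqI)
        (simp_all add: power2_eq_square algebra_simps cos_squared_eq[unfolded power2_eq_square])
    then show ?thesis using w by (simp only:) simp
  qed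
  have R1: "Re (w / (1 + w)) = 1/2"
  proof -
    have "(1 + cos \<theta>)\<^sup>2 + (sin \<theta>)\<^sup>2 \<noteq> 0"
      using sin_gt_zero[OF \<theta>] by (simp add: sum_power2_eq_zero_iff)
    moreover have "cos \<theta> * (1 + cos \<theta>) + sin \<theta> * sin \<theta> = 1/2 * ((1 + cos \<theta>)\<^sup>2 + (sin \<theta>)\<^sup>2)"
      by (simp add: power2_eq_square algebra_simps sin_squared_eq[unfolded power2_eq_square])
    ultimately show ?thesis by (simp add: w_def Re_divide divide_eq_eq)
  qed
  have R2: "Re (w / (1 - w)) = - 1/2"
  proof -
    have "(1 - cos \<theta>)\<^sup>2 + (sin \<theta>)\<^sup>2 \<noteq> 0"
      using sin_gt_zero[OF \<theta>] by (simp add: sum_power2_eq_zero_iff)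
    moreover have "cos \<theta> * (1 - cos \<theta>) - sin \<theta> * sin \<theta> = - 1/2 * ((1 - cos \<theta>)\<^sup>2 + (sin \<theta>)\<^sup>2)"
      by (simp add: power2_eq_square algebra_simps sin_squared_eq[unfolded power2_eq_square])
    ultimately have "(cos \<theta> * (1 - cos \<theta>) - sin \<theta> * sin \<theta>) / ((1 - cos \<theta>)\<^sup>2 + (sin \<theta>)\<^sup>2) = - 1/2"
      by (metis nonzero_mult_div_cancel_right)
    then show ?thesis by (simp add: w_def Re_divide)
  qed
  have "w * lg_weight_dlog a b w = of_real b * (w / (1 + w)) - of_real a * (w / (1 - w))"
    by (simp add: lg_weight_dlog_def algebra_simps)
  then have "Re (w * lg_weight_dlog a b w) = b * Re (w / (1 + w)) - a * Re (w / (1 - w))"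
    by (simp only: minus_complex.simps times_complex.simps Re_complex_of_real Im_complex_of_real
        mult_zero_left diff_zero)
  then have "Re (w * lg_weight_dlog a b w) = (\<alpha> + \<beta> + 1) / 2"
    unfolding R1 R2 a_def b_def by (simp add: field_simps)
  then obtain s where s: "w * lg_weight_dlog a b w = of_real ((\<alpha> + \<beta> + 1) / 2) + \<i> * of_real s"
    by (metis complex_eq)
  have "w * lg_deriv \<alpha> \<beta> n w = w ^ n * lg_weight a b w
      * (of_real f1 * ((w\<^sup>2 - 1) / (4 * w)) + (of_nat n + w * lg_weight_dlog a b w) * of_real P)"
    using lg_deriv_factorised[OF w(1,2), of \<alpha> \<beta> n]
    unfolding a_def[symmetric] b_def[symmetric] jacobi_arg_cis[of \<theta>, folded w_def] f1 poly_jacobi_shifted_of_real P_def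
    by simp
  also have "\<dots> = cis (- darboux_phase \<alpha> \<beta> \<theta> n)
    * (of_real ((real n + (\<alpha> + \<beta> + 1) / 2) * (darboux_weight \<alpha> \<beta> \<theta> * P))
       + \<i> * of_real (darboux_weight \<alpha> \<beta> \<theta> * (s * P - f1 * sin \<theta> / 2)))"
    unfolding Dy s darboux_phase_cis[symmetric] unfolding w_def a_def b_def lg_weight_cis[OF \<theta>]
    by (simp add: algebra_simps)
  finally show ?thesis using that unfolding w_def P_def by blast
qed

lemma jacobi_lead_eq_coeff: "jacobi_coeff \<alpha> \<beta> n n / 4 ^ n = jacobi_lead \<alpha> \<beta> n"
  by (simp add: jacobi_coeff_def jacobi_lead_def)

lemma lg_fun_0: "lg_fun \<alpha> \<beta> n 0 = of_real (jacobi_lead \<alpha> \<beta> n)"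
  by (simp add: lg_fun_def poly_jacobi_disc_0 lg_weight_def jacobi_lead_eq_coeff)

lemma lg_potential_ray_le:
  assumes \<theta>: "0 < \<theta>" "\<theta> < pi"
  shows "norm (lg_potential a b (of_real r * cis (- \<theta>))) \<le> (\<bar>a\<^sup>2 - a\<bar> + \<bar>b\<^sup>2 - b\<bar>) / (sin \<theta>)\<^sup>2"
proof -
  have sin: "0 < sin \<theta>" by (rule sin_gt_zero[OF \<theta>])
  have bound: "norm (of_real c / u\<^sup>2) \<le> \<bar>c\<bar> / (sin \<theta>)\<^sup>2" if "sin \<theta> \<le> norm u" for c and u :: complex
    unfolding norm_divide norm_power norm_of_real
    using that sin by (intro divide_left_mono power_mono mult_pos_pos zero_less_power) auto
  show ?thesis
    unfolding lg_potential_def add_divide_distrib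
    by (rule order_trans[OF norm_triangle_ineq4 add_mono]) (intro bound norm_ray_ge[OF \<theta>])+
qed

text \<open>The estimate \<open>ray_estimate\<close> on the segment from \<open>0\<close> to \<open>e\<^sup>-\<^sup>i\<^sup>\<theta>\<close>. Multiplied by \<open>e\<^sup>i\<^sup>\<psi>\<close>, the
  end value of \<open>2 M v - D v\<close> has real part \<open>M K P\<^sub>n(cos \<theta>)\<close>, and its initial value
  \<open>2 M \<lambda>\<^sub>n\<close> has real part \<open>2 M \<lambda>\<^sub>n cos \<psi>\<close>.\<close>
lemma jacobi_darboux:
  fixes \<alpha> \<beta> \<theta> :: real and n :: nat
  defines "Q \<equiv> (\<bar>(\<alpha> + 1/2)\<^sup>2 - (\<alpha> + 1/2)\<bar> + \<bar>(\<beta> + 1/2)\<^sup>2 - (\<beta> + 1/2)\<bar>) / (sin \<theta>)\<^sup>2"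
    and "M \<equiv> real n + (\<alpha> + \<beta> + 1) / 2"
  assumes \<theta>: "0 < \<theta>" "\<theta> < pi" and M: "1 \<le> M" "3 * Q \<le> M"
  shows "\<bar>darboux_weight \<alpha> \<beta> \<theta> * jacobi_poly \<alpha> \<beta> n (cos \<theta>)
            - 2 * jacobi_lead \<alpha> \<beta> n * cos (darboux_phase \<alpha> \<beta> \<theta> n)\<bar>
         \<le> 4 * Q * \<bar>jacobi_lead \<alpha> \<beta> n\<bar> / M"
proof -
  define w where "w = cis (- \<theta>)"
  define v where "v = (\<lambda>r. lg_fun \<alpha> \<beta> n (of_real r * w))"
  define b where "b = (\<lambda>r. of_real r * w * lg_deriv \<alpha> \<beta> n (of_real r * w))"
  define KP where "KP = darboux_weight \<alpha> \<beta> \<theta> * jacobi_poly \<alpha> \<beta> n (cos \<theta>)"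
  define \<psi> where "\<psi> = darboux_phase \<alpha> \<beta> \<theta> n"
  define c where "c = jacobi_lead \<alpha> \<beta> n"
  have slit: "of_real r * w \<in> slit_domain" for r
    unfolding w_def by (rule ray_in_slit_domain[OF \<theta>])
  have w0: "w \<noteq> 0" by (simp add: w_def)
  have line: "((\<lambda>r. of_real r * w) has_vector_derivative w) (at r)" for r :: real
    using has_vector_derivative_mult_left[OF has_vector_derivative_of_real[OF DERIV_ident], of w] by simp
  have dv: "(v has_vector_derivative w * lg_deriv \<alpha> \<beta> n (of_real r * w)) (at r)" for r
    using field_vector_diff_chain_at[OF line lg_fun_deriv[OF slit], of \<alpha> \<beta> n r]
    by (simp add: v_def o_def)
  have contv: "continuous_on {0..1} v"
    using dv by (intro continuous_at_imp_continuous_on ballI has_vector_derivative_continuous) blast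
  have contb: "continuous_on {0..1} b"
  proof -
    have "continuous_on {0..1} (\<lambda>r. lg_weight (\<alpha> + 1/2) (\<beta> + 1/2) (of_real r * w))"
      by (intro continuous_at_imp_continuous_on ballI
          isCont_o2[where f = "\<lambda>r. of_real r * w", OF _ DERIV_isCont[OF lg_weight_deriv[OF slit]]]
          continuous_intros)
    then show ?thesis
      unfolding b_def lg_deriv_def lg_weight_dlog_def
      using slit_domain_nonzero[OF slit] by (intro continuous_intros) auto
  qed
  obtain R where R: "b 1 = cis (- \<psi>) * (of_real (M * KP) + \<i> * of_real R)"
    using lg_deriv_cis[OF \<theta>, of \<alpha> \<beta> n] unfolding b_def w_def M_def KP_def \<psi>_def by auto
  have v1: "v 1 = cis (- \<psi>) * of_real KP"
    using lg_fun_cis[OF \<theta>, of \<alpha> \<beta> n] unfolding v_def w_def KP_def \<psi>_def by simp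
  have main: "norm (of_real (2 * M) * v 1 - b 1 - of_real (2 * M) * v 0) \<le> 4 * Q * norm (v 0)"
  proof (rule ray_estimate[OF contv contb])
    fix r :: real assume r: "0 < r" "r < 1"
    show "(v has_vector_derivative b r / of_real r) (at r)"
      using dv[of r] r by (simp add: b_def)
    have rw0: "of_real r * w \<noteq> 0" using r w0 by simp
    have "of_real (2 * M) * b r / of_real r = w * (of_real (2 * M) * lg_deriv \<alpha> \<beta> n (of_real r * w))"
      using r by (simp add: b_def)
    moreover have "2 * M = 2 * real n + \<alpha> + \<beta> + 1" by (simp add: M_def)
    ultimately have e: "w * (of_real (2 * real n + \<alpha> + \<beta> + 1) * lg_deriv \<alpha> \<beta> n (of_real r * w)
          + lg_potential (\<alpha> + 1/2) (\<beta> + 1/2) (of_real r * w) * lg_fun \<alpha> \<beta> n (of_real r * w))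
        = of_real (2 * M) * b r / of_real r
          + w * lg_potential (\<alpha> + 1/2) (\<beta> + 1/2) (of_real r * w) * v r"
      by (simp add: v_def distrib_left mult.assoc)
    show "(b has_vector_derivative of_real (2 * M) * b r / of_real r
        + w * lg_potential (\<alpha> + 1/2) (\<beta> + 1/2) (of_real r * w) * v r) (at r)"
      using field_vector_diff_chain_at[OF line lg_deriv_deriv[OF rw0 slit], of \<alpha> \<beta> n]
      unfolding e unfolding b_def o_def .
    show "norm (w * lg_potential (\<alpha> + 1/2) (\<beta> + 1/2) (of_real r * w)) \<le> Q"
      unfolding norm_mult using lg_potential_ray_le[OF \<theta>] by (simp add: w_def Q_def)
  next
    show "b 0 = 0" by (simp add: b_def)
    have "of_real (2 * M) * v 1 - b 1 = cis (- \<psi>) * cnj (of_real (M * KP) + \<i> * of_real R)"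
      unfolding R v1 by (simp add: algebra_simps)
    then show "norm (of_real (2 * M) * v 1 - b 1) = norm (b 1)"
      unfolding R by (simp only: norm_mult complex_mod_cnj)
  qed (use M in \<open>auto simp: Q_def\<close>)
  have v0: "v 0 = of_real c" by (simp add: v_def lg_fun_0 c_def)
  have "M * (KP - 2 * c * cos \<psi>) = Re (cis \<psi> * (of_real (2 * M) * v 1 - b 1 - of_real (2 * M) * v 0))"
  proof -
    have eq: "cis \<psi> * (of_real (2 * M) * v 1 - b 1 - of_real (2 * M) * v 0)
        = (cis \<psi> * cis (- \<psi>)) * (of_real (M * KP) - \<i> * of_real R) - of_real (2 * M * c) * cis \<psi>"
      unfolding R v1 v0 by (simp add: algebra_simps)
    show ?thesis by (subst eq) (simp add: cis_mult algebra_simps)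
  qed
  also have "\<bar>\<dots>\<bar> \<le> norm (of_real (2 * M) * v 1 - b 1 - of_real (2 * M) * v 0)"
    using abs_Re_le_cmod by (metis mult_1 norm_cis norm_mult)
  also have "\<dots> \<le> 4 * Q * \<bar>c\<bar>" using main by (simp add: v0)
  finally have "\<bar>KP - 2 * c * cos \<psi>\<bar> * M \<le> 4 * Q * \<bar>c\<bar>"
    using M by (simp add: abs_mult mult.commute)
  then show ?thesis
    using M unfolding KP_def c_def \<psi>_def by (subst pos_le_divide_eq) auto
qed

section \<open>Tails of series\<close>

lemma tail_inverse_telescope:
  "(\<lambda>k. 1 / (real (N + 1 + k) * (real (N + 1 + k) + 1))) sums (1 / (real N + 1))"
proof -
  have "(\<lambda>k. 1 / (real N + 1 + real k)) \<longlonglongrightarrow> 0" by real_asymp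
  from telescope_sums'[OF this]
  have "(\<lambda>k. 1 / (real N + 1 + real k) - 1 / (real N + 1 + real (Suc k))) sums (1 / (real N + 1))"
    by simp
  moreover have "1 / (real N + 1 + real k) - 1 / (real N + 1 + real (Suc k))
      = 1 / (real (N + 1 + k) * (real (N + 1 + k) + 1))" for k
    by (simp add: divide_simps)
  ultimately show ?thesis by simp
qed

lemma tail_bound:
  fixes d :: "nat \<Rightarrow> real"
  assumes "\<And>n. n > N \<Longrightarrow> \<bar>d n\<bar> \<le> \<epsilon> / (real n * (real n + 1))"
  shows "summable (\<lambda>k. d (N + 1 + k))" "\<bar>\<Sum>k. d (N + 1 + k)\<bar> \<le> \<epsilon> / (real N + 1)"
proof -
  have s: "(\<lambda>k. \<epsilon> * (1 / (real (N + 1 + k) * (real (N + 1 + k) + 1)))) sums (\<epsilon> * (1 / (real N + 1)))"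
    by (intro sums_mult tail_inverse_telescope)
  have le: "norm (d (N + 1 + k)) \<le> \<epsilon> * (1 / (real (N + 1 + k) * (real (N + 1 + k) + 1)))" for k
    using assms[of "N + 1 + k"] by simp
  show "summable (\<lambda>k. d (N + 1 + k))"
    by (rule summable_comparison_test'[OF sums_summable[OF s] le])
  show "\<bar>\<Sum>k. d (N + 1 + k)\<bar> \<le> \<epsilon> / (real N + 1)"
    using norm_suminf_le[OF le sums_summable[OF s]] sums_unique[OF s] by simp
qed

text \<open>Comparison with the telescoping series of \<open>C / (n (n + 1))\<close>, whose tail is exactly
  \<open>C / (N + 1)\<close>.\<close>
lemma tendsto_tail:
  fixes T :: "nat \<Rightarrow> real"
  assumes T: "(\<lambda>n. (real n)\<^sup>2 * T n) \<longlonglongrightarrow> C"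
  shows "summable T" "(\<lambda>N. real N * (\<Sum>k. T (N + 1 + k))) \<longlonglongrightarrow> C"
proof -
  define d where "d = (\<lambda>n. T n - C / (real n * (real n + 1)))"
  have "(\<lambda>n. (real n)\<^sup>2 * T n * ((real n * (real n + 1)) / (real n)\<^sup>2)) \<longlonglongrightarrow> C * 1"
    by (intro tendsto_mult T) real_asymp
  moreover have "\<forall>\<^sub>F n in sequentially. (real n)\<^sup>2 * T n * ((real n * (real n + 1)) / (real n)\<^sup>2)
      = real n * (real n + 1) * T n"
    using eventually_gt_at_top[of 0] by eventually_elim (simp add: field_simps)
  ultimately have lim: "(\<lambda>n. real n * (real n + 1) * T n) \<longlonglongrightarrow> C"
    by (auto elim: Lim_transform_eventually)
  have small: "\<forall>\<^sub>F N in sequentially. \<forall>n>N. \<bar>d n\<bar> \<le> \<epsilon> / (real n * (real n + 1))" if "\<epsilon> > 0" for \<epsilon>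
  proof -
    have "\<forall>\<^sub>F n in sequentially. \<bar>real n * (real n + 1) * T n - C\<bar> < \<epsilon>"
      using tendstoD[OF lim that] by (simp add: dist_real_def)
    then obtain n0 where n0: "\<And>n. n \<ge> n0 \<Longrightarrow> \<bar>real n * (real n + 1) * T n - C\<bar> < \<epsilon>"
      by (auto simp: eventually_sequentially)
    have "\<bar>d n\<bar> \<le> \<epsilon> / (real n * (real n + 1))" if "n > n0" for n
    proof -
      have "real n * (real n + 1) > 0" using that by simp
      then have "d n = (real n * (real n + 1) * T n - C) / (real n * (real n + 1))"
        unfolding d_def by (simp add: field_simps)
      then have "\<bar>d n\<bar> = \<bar>real n * (real n + 1) * T n - C\<bar> / (real n * (real n + 1))"
        by (simp add: abs_mult)
      then show ?thesis using n0[of n] that by (simp add: divide_right_mono)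
    qed
    then show ?thesis
      unfolding eventually_sequentially by (intro exI[of _ n0]) auto
  qed
  have T_eq: "T n = d n + C * (1 / (real n * (real n + 1)))" for n by (simp add: d_def)
  obtain N0 where N0: "\<forall>n>N0. \<bar>d n\<bar> \<le> 1 / (real n * (real n + 1))"
    using eventually_happens'[OF _ small[of 1]] by auto
  have "summable (\<lambda>k. d (N0 + 1 + k))" by (rule tail_bound(1)) (use N0 in auto)
  then have "summable (\<lambda>k. d (k + (N0 + 1)))" by (simp add: add_ac)
  then have sd: "summable d" by (simp only: summable_iff_shift)
  have "summable (\<lambda>k. 1 / (real (k + 1) * (real (k + 1) + 1)))"
    using sums_summable[OF tail_inverse_telescope[of 0]] by (simp add: add_ac)
  then have s1: "summable (\<lambda>n. 1 / (real n * (real n + 1)))"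
    by (subst (asm) summable_iff_shift)
  show "summable T" unfolding T_eq[abs_def] by (intro summable_add summable_mult sd s1)
  have eq: "(\<Sum>k. T (N + 1 + k)) = (\<Sum>k. d (N + 1 + k)) + C * (1 / (real N + 1))" for N
  proof -
    have "summable (\<lambda>k. d (k + (N + 1)))" using sd by (simp only: summable_iff_shift)
    then have "(\<lambda>k. d (N + 1 + k)) sums (\<Sum>k. d (N + 1 + k))"
      by (simp add: add_ac summable_sums)
    from sums_add[OF this sums_mult[OF tail_inverse_telescope[of N], of C]]
    show ?thesis unfolding T_eq by (rule sums_unique[symmetric])
  qed
  have "(\<lambda>N. real N * (\<Sum>k. d (N + 1 + k))) \<longlonglongrightarrow> 0"
  proof (rule tendstoI)
    fix \<epsilon> :: real assume "\<epsilon> > 0"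
    then have "\<epsilon> / 2 > 0" by simp
    from small[OF this] show "\<forall>\<^sub>F N in sequentially. dist (real N * (\<Sum>k. d (N + 1 + k))) 0 < \<epsilon>"
    proof eventually_elim
      case (elim N)
      have "\<bar>\<Sum>k. d (N + 1 + k)\<bar> \<le> (\<epsilon> / 2) / (real N + 1)"
        by (rule tail_bound(2)) (use elim in auto)
      then have "real N * \<bar>\<Sum>k. d (N + 1 + k)\<bar> \<le> real N * ((\<epsilon> / 2) / (real N + 1))"
        by (rule mult_left_mono) simp
      also have "\<dots> < \<epsilon>" using \<open>\<epsilon> > 0\<close> by (simp add: field_simps add_nonneg_pos)
      finally show ?case by (simp add: abs_mult)
    qed
  qed
  moreover have "(\<lambda>N. real N * (C * (1 / (real N + 1)))) \<longlonglongrightarrow> C" by real_asymp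
  ultimately show "(\<lambda>N. real N * (\<Sum>k. T (N + 1 + k))) \<longlonglongrightarrow> C"
    unfolding eq distrib_left using tendsto_add by fastforce
qed

text \<open>Here the comparison series is \<open>1 / n\<^sup>2 - 1 / (n + 1)\<^sup>2\<close>, which dominates \<open>1 / (n + 1)\<^sup>3\<close>.\<close>
lemma cube_tail:
  fixes e :: "nat \<Rightarrow> real"
  assumes N: "N \<ge> 1" and e: "\<And>n. n > N \<Longrightarrow> \<bar>e n\<bar> \<le> B / real n ^ 3"
  shows "\<bar>\<Sum>k. e (N + 1 + k)\<bar> \<le> B / (real N)\<^sup>2"
proof -
  have "0 \<le> B / real (N + 1) ^ 3" using order_trans[OF abs_ge_zero e[of "N + 1"]] by simp
  then have B: "B \<ge> 0" by (simp add: zero_le_divide_iff)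
  have lim: "(\<lambda>k. 1 / (real N + real k)\<^sup>2) \<longlonglongrightarrow> 0" by real_asymp
  have s: "(\<lambda>k. B * (1 / (real N + real k)\<^sup>2 - 1 / (real N + real (Suc k))\<^sup>2)) sums (B * (1 / (real N)\<^sup>2))"
    using sums_mult[OF telescope_sums'[OF lim], of B] by simp
  have le: "norm (e (N + 1 + k)) \<le> B * (1 / (real N + real k)\<^sup>2 - 1 / (real N + real (Suc k))\<^sup>2)" for k
  proof -
    define x where "x = real N + real k"
    have x: "x \<ge> 1" using N by (simp add: x_def)
    have "1 / (x + 1) ^ 3 \<le> 1 / x\<^sup>2 - 1 / (x + 1)\<^sup>2"
    proof -
      have le: "x\<^sup>2 \<le> (2 * x + 1) * (x + 1)" using x by (simp add: algebra_simps power2_eq_square)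
      have e1: "1 / x\<^sup>2 - 1 / (x + 1)\<^sup>2 = (2 * x + 1) * (x + 1) / (x\<^sup>2 * (x + 1) ^ 3)"
        using x by (simp add: divide_simps) (simp add: power2_eq_square power3_eq_cube algebra_simps)
      have e2: "1 / (x + 1) ^ 3 = x\<^sup>2 / (x\<^sup>2 * (x + 1) ^ 3)" using x by simp
      show ?thesis unfolding e1 e2 using x by (intro divide_right_mono le) auto
    qed
    then have "B * (1 / (x + 1) ^ 3) \<le> B * (1 / x\<^sup>2 - 1 / (x + 1)\<^sup>2)" by (rule mult_left_mono[OF _ B])
    then show ?thesis using e[of "N + 1 + k"] by (simp add: x_def add_ac)
  qed
  show ?thesis using norm_suminf_le[OF le sums_summable[OF s]] sums_unique[OF s] by simp
qed

lemma abel_partial_sum: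
  fixes T F :: "nat \<Rightarrow> real"
  assumes dec: "\<And>n. n \<ge> m \<Longrightarrow> T (Suc n) \<le> T n" and F: "\<And>n. \<bar>F n\<bar> \<le> B"
  shows "\<bar>(\<Sum>k<j. T (m + k) * (F (Suc (m + k)) - F (m + k))) - T (m + j) * F (m + j) + T m * F m\<bar>
     \<le> B * (T m - T (m + j))"
proof (induction j)
  case (Suc j)
  have "\<bar>(T (m + j) - T (Suc (m + j))) * F (Suc (m + j))\<bar> \<le> (T (m + j) - T (Suc (m + j))) * B"
    unfolding abs_mult using dec[of "m + j"] F by (intro mult_mono) auto
  with Suc.IH show ?case by (simp add: algebra_simps)
qed simp

text \<open>The cosines have the bounded partial sums \<open>F n\<close>, up to a constant, since
  \<open>2 sin (\<delta>/2) cos t = sin (t + \<delta>/2) - sin (t - \<delta>/2)\<close>; partial summation against the monotone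
  \<open>T\<close> leaves only its first value.\<close>
lemma oscillating_tail:
  fixes T :: "nat \<Rightarrow> real"
  assumes dec: "\<And>n. n \<ge> m \<Longrightarrow> T (Suc n) \<le> T n" and pos: "\<And>n. n \<ge> m \<Longrightarrow> 0 \<le> T n"
    and sin: "sin (\<delta> / 2) \<noteq> 0" and summ: "summable (\<lambda>k. T (m + k) * cos (real (m + k) * \<delta> + c))"
  shows "\<bar>\<Sum>k. T (m + k) * cos (real (m + k) * \<delta> + c)\<bar> \<le> T m / \<bar>sin (\<delta> / 2)\<bar>"
proof -
  define F where "F = (\<lambda>n::nat. sin ((real n - 1/2) * \<delta> + c) / (2 * sin (\<delta> / 2)))"
  define B where "B = 1 / (2 * \<bar>sin (\<delta> / 2)\<bar>)"
  have F: "\<bar>F n\<bar> \<le> B" for n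
    unfolding F_def B_def abs_divide abs_mult abs_numeral by (intro divide_right_mono) auto
  have diff: "F (Suc n) - F n = cos (real n * \<delta> + c)" for n
  proof -
    have "sin ((real (Suc n) - 1/2) * \<delta> + c) - sin ((real n - 1/2) * \<delta> + c)
        = sin ((real n * \<delta> + c) + \<delta> / 2) - sin ((real n * \<delta> + c) - \<delta> / 2)"
      by (simp add: algebra_simps)
    also have "\<dots> = 2 * sin (\<delta> / 2) * cos (real n * \<delta> + c)"
      unfolding sin_add sin_diff by simp
    finally show ?thesis using sin unfolding F_def by (simp flip: diff_divide_distrib)
  qed
  have "\<bar>\<Sum>k<j. T (m + k) * cos (real (m + k) * \<delta> + c)\<bar> \<le> T m / \<bar>sin (\<delta> / 2)\<bar>" for j
  proof -
    have a: "\<bar>(\<Sum>k<j. T (m + k) * cos (real (m + k) * \<delta> + c)) - T (m + j) * F (m + j) + T m * F m\<bar>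
       \<le> B * (T m - T (m + j))"
      using abel_partial_sum[of m T F B j, OF dec F] unfolding diff .
    have b: "\<bar>T (m + i) * F (m + i)\<bar> \<le> B * T (m + i)" for i
      unfolding abs_mult using pos[of "m + i"] mult_right_mono[OF F[of "m + i"], of "T (m + i)"]
      by (simp add: mult.commute)
    have "\<bar>\<Sum>k<j. T (m + k) * cos (real (m + k) * \<delta> + c)\<bar> \<le> 2 * B * T m"
      using a b[of j] b[of 0] by (simp add: algebra_simps)
    then show ?thesis by (simp add: B_def)
  qed
  moreover have "(\<lambda>j. \<bar>\<Sum>k<j. T (m + k) * cos (real (m + k) * \<delta> + c)\<bar>)
      \<longlonglongrightarrow> \<bar>\<Sum>k. T (m + k) * cos (real (m + k) * \<delta> + c)\<bar>"
    by (intro tendsto_rabs summable_LIMSEQ summ)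
  ultimately show ?thesis by (intro LIMSEQ_le_const2) auto
qed

section \<open>The amplitude of the summands\<close>

text \<open>For \<open>c > 0\<close> this is Gauss's product for \<open>\<Gamma>(c)\<close>. The functional equation carries it from \<open>c + 1\<close>
  to \<open>c\<close>, hence to every real \<open>c\<close>, nonpositive integers included.\<close>
lemma Gamma_shift_asymp:
  "(\<lambda>n. Gamma (real n + c) / (fact n * real n powr (c - 1))) \<longlonglongrightarrow> 1"
proof -
  define r where "r = (\<lambda>(c::real) n. Gamma (real n + c) / (fact n * real n powr (c - 1)))"
  have pos: "r c \<longlonglongrightarrow> 1" if "c > 0" for c
  proof -
    have c: "c \<notin> \<int>\<^sub>\<le>\<^sub>0" using that by auto
    have G: "Gamma c \<noteq> 0" using Gamma_real_pos[OF that] by simp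
    have "(\<lambda>n. Gamma c / Gamma_series' c n) \<longlonglongrightarrow> Gamma c / Gamma c"
      by (intro tendsto_divide tendsto_const Gamma_series'_LIMSEQ G)
    moreover have "\<forall>\<^sub>F n in sequentially. Gamma c / Gamma_series' c n = r c n"
      using eventually_gt_at_top[of 0]
    proof eventually_elim
      case (elim n)
      then have "fact n = real n * fact (n - 1)" by (cases n) auto
      then show ?case
        using elim G pochhammer_Gamma[OF c, of n] unfolding r_def Gamma_series'_def
        by (simp add: powr_def powr_diff exp_diff field_simps) 
    qed
    ultimately show ?thesis using G by (auto elim: Lim_transform_eventually)
  qed
  have down: "r c \<longlonglongrightarrow> 1" if "r (c + 1) \<longlonglongrightarrow> 1" for c
  proof -
    have "(\<lambda>n. r (c + 1) n * (real n / (real n + c))) \<longlonglongrightarrow> 1 * 1"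
      by (intro tendsto_mult that) real_asymp
    moreover have "\<forall>\<^sub>F n in sequentially. real n + c > 0" by real_asymp
    then have "\<forall>\<^sub>F n in sequentially. r (c + 1) n * (real n / (real n + c)) = r c n"
      using eventually_gt_at_top[of 0]
    proof eventually_elim
      case (elim n)
      have "Gamma (real n + (c + 1)) = (real n + c) * Gamma (real n + c)"
        using Gamma_plus1[of "real n + c"] elim by (force simp: add_ac)
      moreover have "real n powr (c - 1) = real n powr c / real n" using elim by (simp add: powr_diff)
      ultimately show ?case using elim unfolding r_def by simp
    qed
    ultimately show ?thesis by (auto elim: Lim_transform_eventually)
  qed
  have "r (c + real j) \<longlonglongrightarrow> 1 \<Longrightarrow> r c \<longlonglongrightarrow> 1" for j
  proof (induction j)
    case (Suc j)
    then show ?case using down[of "c + real j"] by (simp add: add_ac)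
  qed simp
  moreover obtain j :: nat where "real j > - c" using reals_Archimedean2 by blast
  then have "r (c + real j) \<longlonglongrightarrow> 1" by (intro pos) simp
  ultimately show ?thesis unfolding r_def by blast
qed

definition jacobi_norm_factor :: "real \<Rightarrow> real \<Rightarrow> nat \<Rightarrow> real" where
  "jacobi_norm_factor \<alpha> \<beta> n =
     fact n * (2 * real n + \<alpha> + \<beta> + 1) * Gamma (real n + \<alpha> + \<beta> + 1)
       / (2 powr (\<alpha> + \<beta> + 1) * Gamma (real n + \<alpha> + 1) * Gamma (real n + \<beta> + 1))
       / (real n * (real n + \<alpha> + \<beta> + 1))"

text \<open>The amplitude of the cosine products in the asymptotic form of the summands.\<close>
definition jacobi_amplitude :: "real \<Rightarrow> real \<Rightarrow> nat \<Rightarrow> real" where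
  "jacobi_amplitude \<alpha> \<beta> n = jacobi_norm_factor \<alpha> \<beta> n * (jacobi_lead \<alpha> \<beta> n)\<^sup>2"

lemma eventually_args_pos:
  fixes \<alpha> \<beta> :: real
  shows "\<forall>\<^sub>F n in sequentially. 0 < n \<and> 0 < real n + \<alpha> + 1 \<and> 0 < real n + \<beta> + 1
     \<and> 0 < real n + \<alpha> + \<beta> + 1 \<and> 0 < real n + (\<alpha> + \<beta> + 1) / 2"
  by (intro eventually_conj eventually_gt_at_top) real_asymp+

lemma Gamma_succ:
  fixes x :: real
  assumes "0 < x"
  shows "Gamma (x + 1) = x * Gamma x"
proof -
  have "x \<notin> \<int>\<^sub>\<le>\<^sub>0" using assms by auto
  then show ?thesis by (rule Gamma_plus1)
qed

lemma Gamma_duplication_real: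
  fixes x :: real
  assumes "0 < x"
  shows "Gamma x * Gamma (x + 1/2) = 2 powr (1 - 2 * x) * sqrt pi * Gamma (2 * x)"
proof -
  have "complex_of_real x \<notin> \<int>\<^sub>\<le>\<^sub>0" "complex_of_real x + 1/2 \<notin> \<int>\<^sub>\<le>\<^sub>0"
    using assms by (auto simp: elim!: nonpos_Ints_cases simp: complex_eq_iff)
  from Gamma_legendre_duplication[OF this]
  have "Gamma (complex_of_real x) * Gamma (complex_of_real (x + 1/2))
      = exp (of_real ((1 - 2 * x) * ln 2)) * of_real (sqrt pi) * Gamma (complex_of_real (2 * x))"
    by simp
  then have "complex_of_real (Gamma x * Gamma (x + 1/2))
      = complex_of_real (exp ((1 - 2 * x) * ln 2) * sqrt pi * Gamma (2 * x))"
    by (simp only: Gamma_complex_of_real exp_of_real flip: of_real_mult)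
  then show ?thesis by (simp only: of_real_eq_iff powr_def) simp
qed

text \<open>Duplication of \<open>\<Gamma>(2 n + \<alpha> + \<beta> + 1)\<close> cancels the powers of \<open>4\<close>, so that only ratios of the kind
  treated in \<open>Gamma_shift_asymp\<close> remain.\<close>
lemma jacobi_lead_Gamma:
  assumes "0 < real n + \<alpha> + \<beta> + 1" "0 < real n + (\<alpha> + \<beta> + 1) / 2"
  shows "jacobi_lead \<alpha> \<beta> n = 2 powr (\<alpha> + \<beta>) / sqrt pi *
     (Gamma (real n + (\<alpha> + \<beta> + 1) / 2) * Gamma (real n + ((\<alpha> + \<beta>) / 2 + 1)))
       / (fact n * Gamma (real n + (\<alpha> + \<beta> + 1)))"
proof -
  define z where "z = real n + (\<alpha> + \<beta> + 1) / 2"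
  have w: "real n + \<alpha> + \<beta> + 1 \<notin> \<int>\<^sub>\<le>\<^sub>0"
    using assms by (auto simp: z_def)
  have "(4::real) ^ n = 2 powr (2 * real n)"
    by (simp add: powr_realpow power_mult[symmetric] flip: powr_powr)
  moreover have "- (1 - 2 * z) = \<alpha> + \<beta> + 2 * real n" by (simp add: z_def field_simps)
  ultimately have "2 powr (\<alpha> + \<beta>) * 4 ^ n = (2::real) powr - (1 - 2 * z)"
    by (simp only: powr_add)
  then have "(2::real) powr (1 - 2 * z) = 1 / (2 powr (\<alpha> + \<beta>) * 4 ^ n)"
    by (simp only: powr_minus_divide) simp
  then have dup: "Gamma z * Gamma (z + 1/2) = 1 / (2 powr (\<alpha> + \<beta>) * 4 ^ n) * sqrt pi * Gamma (2 * z)"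
    using Gamma_duplication_real[of z] assms by (simp add: z_def)
  have zz: "2 * z = real n + \<alpha> + \<beta> + 1 + real n" "z + 1/2 = real n + ((\<alpha> + \<beta>) / 2 + 1)"
    by (auto simp: z_def field_simps)
  have "Gamma (2 * z) / 4 ^ n = 2 powr (\<alpha> + \<beta>) / sqrt pi * (Gamma z * Gamma (z + 1/2))"
    unfolding dup by simp
  then show ?thesis
    unfolding jacobi_lead_def pochhammer_Gamma[OF w] zz z_def[symmetric]
    by (simp add: add_ac) (metis divide_divide_eq_left mult.commute)
qed

lemma jacobi_amplitude_asymp:
  "(\<lambda>n. (real n)\<^sup>2 * jacobi_amplitude \<alpha> \<beta> n) \<longlonglongrightarrow> 2 powr (\<alpha> + \<beta>) / pi"
proof -
  define \<sigma> where "\<sigma> = \<alpha> + \<beta>"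
  define r where "r = (\<lambda>c n. Gamma (real n + c) / (fact n * real n powr (c - 1)))"
  have r: "r c \<longlonglongrightarrow> 1" for c unfolding r_def by (rule Gamma_shift_asymp)
  have "(\<lambda>n. (2 powr \<sigma>)\<^sup>2 / pi * (r ((\<sigma> + 1) / 2) n * r (\<sigma> / 2 + 1) n / r (\<sigma> + 1) n)\<^sup>2 *
        ((2 * real n + \<sigma> + 1) / (real n + \<sigma> + 1) * (r (\<sigma> + 1) n / (r (\<alpha> + 1) n * r (\<beta> + 1) n))
          / 2 powr (\<sigma> + 1)))
      \<longlonglongrightarrow> (2 powr \<sigma>)\<^sup>2 / pi * (1 * 1 / 1)\<^sup>2 * (2 * (1 / (1 * 1)) / 2 powr (\<sigma> + 1))"
  proof (intro tendsto_intros r)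
    show "(\<lambda>n. (2 * real n + \<sigma> + 1) / (real n + \<sigma> + 1)) \<longlonglongrightarrow> 2" by real_asymp
  qed auto
  also have "(2 powr \<sigma>)\<^sup>2 / pi * (1 * 1 / 1)\<^sup>2 * (2 * (1 / (1 * 1)) / 2 powr (\<sigma> + 1)) = 2 powr \<sigma> / pi"
    by (simp add: powr_add power2_eq_square)
  finally have lim: "(\<lambda>n. (2 powr \<sigma>)\<^sup>2 / pi * (r ((\<sigma> + 1) / 2) n * r (\<sigma> / 2 + 1) n / r (\<sigma> + 1) n)\<^sup>2 *
        ((2 * real n + \<sigma> + 1) / (real n + \<sigma> + 1) * (r (\<sigma> + 1) n / (r (\<alpha> + 1) n * r (\<beta> + 1) n))
          / 2 powr (\<sigma> + 1))) \<longlonglongrightarrow> 2 powr \<sigma> / pi" .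
  have "\<forall>\<^sub>F n in sequentially. (2 powr \<sigma>)\<^sup>2 / pi * (r ((\<sigma> + 1) / 2) n * r (\<sigma> / 2 + 1) n / r (\<sigma> + 1) n)\<^sup>2 *
        ((2 * real n + \<sigma> + 1) / (real n + \<sigma> + 1) * (r (\<sigma> + 1) n / (r (\<alpha> + 1) n * r (\<beta> + 1) n))
          / 2 powr (\<sigma> + 1)) = (real n)\<^sup>2 * jacobi_amplitude \<alpha> \<beta> n"
    using eventually_args_pos[of \<alpha> \<beta>]
  proof eventually_elim
    case (elim n)
    define A where "A = real n powr \<alpha>"
    define B where "B = real n powr \<beta>"
    have pos: "A > 0" "B > 0" "real n > 0" using elim by (auto simp: A_def B_def)
    have G: "Gamma (real n + c) = r c n * fact n * real n powr (c - 1)" for c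
      using elim by (simp add: r_def)
    have AB: "real n powr \<sigma> = A * B" by (simp add: A_def B_def \<sigma>_def powr_add)
    define X where "X = real n powr ((\<sigma> + 1) / 2 - 1) * real n powr (\<sigma> / 2 + 1 - 1)"
    have X: "X\<^sup>2 = (A * B)\<^sup>2 / real n"
    proof -
      have "X\<^sup>2 = real n powr (\<sigma> + \<sigma> - 1)"
        unfolding X_def power2_eq_square by (simp flip: powr_add)
      also have "\<dots> = (A * B)\<^sup>2 / real n"
        using pos by (simp only: powr_diff powr_add AB) (simp add: power2_eq_square)
      finally show ?thesis .
    qed
    have "jacobi_lead \<alpha> \<beta> n = 2 powr \<sigma> / sqrt pi *
         (Gamma (real n + (\<sigma> + 1) / 2) * Gamma (real n + (\<sigma> / 2 + 1)))
         / (fact n * Gamma (real n + (\<sigma> + 1)))"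
      using jacobi_lead_Gamma[of n \<alpha> \<beta>] elim unfolding \<sigma>_def by simp
    also have "\<dots> = 2 powr \<sigma> / sqrt pi *
         (r ((\<sigma> + 1) / 2) n * r (\<sigma> / 2 + 1) n / r (\<sigma> + 1) n) * (X / (A * B))"
      unfolding G X_def by (simp add: AB mult_ac)
    finally have "jacobi_lead \<alpha> \<beta> n = 2 powr \<sigma> / sqrt pi *
         (r ((\<sigma> + 1) / 2) n * r (\<sigma> / 2 + 1) n / r (\<sigma> + 1) n) * (X / (A * B))" .
    then have L2: "(jacobi_lead \<alpha> \<beta> n)\<^sup>2 = (2 powr \<sigma>)\<^sup>2 / pi *
         (r ((\<sigma> + 1) / 2) n * r (\<sigma> / 2 + 1) n / r (\<sigma> + 1) n)\<^sup>2 / real n"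
      using pos by (simp add: power_mult_distrib power_divide X)
    have args: "real n + \<alpha> + \<beta> + 1 = real n + (\<sigma> + 1)" "real n + \<alpha> + 1 = real n + (\<alpha> + 1)"
      "real n + \<beta> + 1 = real n + (\<beta> + 1)" "2 * real n + \<alpha> + \<beta> + 1 = 2 * real n + \<sigma> + 1"
      "\<alpha> + \<beta> + 1 = \<sigma> + 1"
      by (auto simp: \<sigma>_def)
    have s: "real n + (\<sigma> + 1) \<noteq> 0" using elim by (simp add: \<sigma>_def)
    have "jacobi_norm_factor \<alpha> \<beta> n = (2 * real n + \<sigma> + 1) / (real n + \<sigma> + 1)
        * (r (\<sigma> + 1) n / (r (\<alpha> + 1) n * r (\<beta> + 1) n)) / 2 powr (\<sigma> + 1) / real n"
      unfolding jacobi_norm_factor_def args G using pos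
      by (simp add: AB A_def[symmetric] B_def[symmetric] add.assoc mult_ac)
    then show ?case
      unfolding jacobi_amplitude_def L2 using pos by (simp add: power2_eq_square mult_ac)
  qed
  with lim show ?thesis unfolding \<sigma>_def by (auto elim: Lim_transform_eventually)
qed

lemma jacobi_lead_Suc:
  "4 * (real n + 1) * (real n + \<alpha> + \<beta> + 1) * jacobi_lead \<alpha> \<beta> (Suc n)
    = (2 * real n + \<alpha> + \<beta> + 1) * (2 * real n + \<alpha> + \<beta> + 2) * jacobi_lead \<alpha> \<beta> n"
proof -
  define z where "z = real n + \<alpha> + \<beta> + 1"
  have "z * pochhammer (z + 1) (Suc n) = pochhammer z n * (z + real n) * (z + real n + 1)"
    unfolding pochhammer_rec[symmetric] by (simp add: pochhammer_Suc algebra_simps)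
  moreover have "z + 1 = real (Suc n) + \<alpha> + \<beta> + 1" "z + real n = 2 * real n + \<alpha> + \<beta> + 1"
    by (auto simp: z_def)
  ultimately have "z * pochhammer (real (Suc n) + \<alpha> + \<beta> + 1) (Suc n) =
     pochhammer z n * (2 * real n + \<alpha> + \<beta> + 1) * (2 * real n + \<alpha> + \<beta> + 2)"
    by (simp add: add_ac)
  then have "4 * (real n + 1) * (z * pochhammer (real (Suc n) + \<alpha> + \<beta> + 1) (Suc n)) / (fact (Suc n) * 4 ^ Suc n)
     = 4 * (real n + 1) * (pochhammer z n * (2 * real n + \<alpha> + \<beta> + 1) * (2 * real n + \<alpha> + \<beta> + 2)) / (fact (Suc n) * 4 ^ Suc n)"
    by simp
  also have "\<dots> = (2 * real n + \<alpha> + \<beta> + 1) * (2 * real n + \<alpha> + \<beta> + 2) * jacobi_lead \<alpha> \<beta> n"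
    unfolding jacobi_lead_def z_def[symmetric] fact_Suc of_nat_Suc power_Suc
    by (simp add: divide_simps)
  finally show ?thesis unfolding jacobi_lead_def z_def[symmetric] by (simp add: mult_ac)
qed

lemma jacobi_norm_factor_Suc:
  assumes "0 < n" "0 < real n + \<alpha> + 1" "0 < real n + \<beta> + 1"
     "0 < real n + \<alpha> + \<beta> + 1" "0 < real n + (\<alpha> + \<beta> + 1) / 2"
  shows "jacobi_norm_factor \<alpha> \<beta> (Suc n) = jacobi_norm_factor \<alpha> \<beta> n *
    ((2 * real n + \<alpha> + \<beta> + 3) * (real n + \<alpha> + \<beta> + 1)\<^sup>2 * real n
      / ((2 * real n + \<alpha> + \<beta> + 1) * (real n + \<alpha> + 1) * (real n + \<beta> + 1) * (real n + \<alpha> + \<beta> + 2)))"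
proof -
  define s p q where "s = real n + \<alpha> + \<beta> + 1" and "p = real n + \<alpha> + 1" and "q = real n + \<beta> + 1"
  have pos: "0 < s" "0 < p" "0 < q" "0 < real n" "0 < real n + s"
    using assms by (auto simp: s_def p_def q_def)
  have e: "real n + 1 + \<alpha> + \<beta> + 1 = s + 1" "real n + 1 + \<alpha> + 1 = p + 1"
    "real n + 1 + \<beta> + 1 = q + 1" "real n + \<alpha> + \<beta> + 1 = s" "real n + \<alpha> + 1 = p"
    "real n + \<beta> + 1 = q" "2 * real n + \<alpha> + \<beta> + 1 = real n + s"
    "2 * (real n + 1) + \<alpha> + \<beta> + 1 = real n + s + 2" "2 * real n + \<alpha> + \<beta> + 3 = real n + s + 2"
    "real n + \<alpha> + \<beta> + 2 = s + 1" "real (Suc n) = real n + 1" "(fact (Suc n) :: real) = (real n + 1) * fact n"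
    by (auto simp: s_def p_def q_def)
  have G: "Gamma p > 0" "Gamma q > 0" using pos by (auto intro: Gamma_real_pos)
  show ?thesis
    unfolding jacobi_norm_factor_def e Gamma_succ[OF pos(1)] Gamma_succ[OF pos(2)] Gamma_succ[OF pos(3)]
    using pos G by (simp add: divide_simps) (simp add: power2_eq_square mult_ac)
qed

text \<open>The ratio of consecutive amplitudes is a rational function \<open>\<rho>\<close> of \<open>n\<close> with
  \<open>n (1 - \<rho> n)\<close> tending to \<open>2\<close>, so it is eventually below \<open>1\<close>.\<close>
lemma jacobi_amplitude_eventually_decreasing:
  "\<forall>\<^sub>F n in sequentially. 0 \<le> jacobi_amplitude \<alpha> \<beta> n
     \<and> jacobi_amplitude \<alpha> \<beta> (Suc n) \<le> jacobi_amplitude \<alpha> \<beta> n"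
proof -
  define \<sigma> where "\<sigma> = \<alpha> + \<beta>"
  define \<rho> where "\<rho> = (\<lambda>n::nat. (2 * real n + \<sigma> + 1) * (2 * real n + \<sigma> + 2)\<^sup>2 * (2 * real n + \<sigma> + 3) * real n
      / (16 * (real n + 1)\<^sup>2 * (real n + \<alpha> + 1) * (real n + \<beta> + 1) * (real n + \<sigma> + 2)))"
  have "(\<lambda>n. real n * (1 - \<rho> n)) \<longlonglongrightarrow> 2"
    unfolding \<rho>_def \<sigma>_def by real_asymp (simp add: field_simps)
  then have "\<forall>\<^sub>F n in sequentially. real n * (1 - \<rho> n) > 0"
    by (rule order_tendstoD) simp
  then show ?thesis
    using eventually_args_pos[of \<alpha> \<beta>]
  proof eventually_elim
    case (elim n)
    then have pos: "0 < n" "0 < real n + \<alpha> + 1" "0 < real n + \<beta> + 1"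
     "0 < real n + \<alpha> + \<beta> + 1" "0 < real n + (\<alpha> + \<beta> + 1) / 2"
      by auto
    have \<rho>: "\<rho> n \<le> 1" using elim by (simp add: zero_less_mult_iff)
    have "Gamma (real n + \<alpha> + 1) > 0" "Gamma (real n + \<beta> + 1) > 0" "Gamma (real n + \<alpha> + \<beta> + 1) > 0"
      using pos by (auto intro: Gamma_real_pos)
    then have W: "0 \<le> jacobi_norm_factor \<alpha> \<beta> n"
      unfolding jacobi_norm_factor_def using pos
      by (intro divide_nonneg_nonneg mult_nonneg_nonneg) auto
    then have T: "0 \<le> jacobi_amplitude \<alpha> \<beta> n" by (simp add: jacobi_amplitude_def)
    define s where "s = real n + \<alpha> + \<beta> + 1"
    have s: "0 < s" using pos by (simp add: s_def)
    have \<sigma>: "2 * real n + \<sigma> + 1 = 2 * real n + \<alpha> + \<beta> + 1" "2 * real n + \<sigma> + 2 = 2 * real n + \<alpha> + \<beta> + 2"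
      by (auto simp: \<sigma>_def)
    have "jacobi_lead \<alpha> \<beta> (Suc n) * (4 * (real n + 1) * s)
       = (2 * real n + \<sigma> + 1) * (2 * real n + \<sigma> + 2) * jacobi_lead \<alpha> \<beta> n"
      using jacobi_lead_Suc[of n \<alpha> \<beta>] unfolding s_def[symmetric] \<sigma> by (simp only: mult_ac)
    then have "jacobi_lead \<alpha> \<beta> (Suc n) =
       (2 * real n + \<sigma> + 1) * (2 * real n + \<sigma> + 2) / (4 * (real n + 1) * s) * jacobi_lead \<alpha> \<beta> n"
      unfolding times_divide_eq_left using s by (subst nonzero_eq_divide_eq) auto
    then have sq: "(jacobi_lead \<alpha> \<beta> (Suc n))\<^sup>2 =
       ((2 * real n + \<sigma> + 1) * (2 * real n + \<sigma> + 2) / (4 * (real n + 1) * s))\<^sup>2 * (jacobi_lead \<alpha> \<beta> n)\<^sup>2"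
      by (simp only: power_mult_distrib)
    have "jacobi_amplitude \<alpha> \<beta> (Suc n) = jacobi_amplitude \<alpha> \<beta> n *
      (((2 * real n + \<sigma> + 3) * s\<^sup>2 * real n
      / ((2 * real n + \<sigma> + 1) * (real n + \<alpha> + 1) * (real n + \<beta> + 1) * (real n + \<sigma> + 2)))
      * ((2 * real n + \<sigma> + 1) * (2 * real n + \<sigma> + 2) / (4 * (real n + 1) * s))\<^sup>2)"
      unfolding jacobi_amplitude_def jacobi_norm_factor_Suc[OF pos] sq s_def \<sigma>_def
      by (simp only: add.assoc mult_ac)
    also have "((2 * real n + \<sigma> + 3) * s\<^sup>2 * real n
      / ((2 * real n + \<sigma> + 1) * (real n + \<alpha> + 1) * (real n + \<beta> + 1) * (real n + \<sigma> + 2)))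
      * ((2 * real n + \<sigma> + 1) * (2 * real n + \<sigma> + 2) / (4 * (real n + 1) * s))\<^sup>2 = \<rho> n"
    proof -
      have "2 * real n + \<sigma> + 1 \<noteq> 0" using pos by (simp add: \<sigma>_def)
      then show ?thesis
        unfolding \<rho>_def power_divide power_mult_distrib using s by (simp add: power2_eq_square mult_ac)
    qed
    finally show ?case using T mult_left_mono[OF \<rho> T] by simp
  qed
qed

section \<open>Tails of the Jacobi series\<close>

lemma jacobi_summand_eq:
  "jacobi_summand \<alpha> \<beta> x y n = jacobi_norm_factor \<alpha> \<beta> n * (jacobi_poly \<alpha> \<beta> n x * jacobi_poly \<alpha> \<beta> n y)"
  by (simp add: jacobi_summand_def jacobi_norm_factor_def)

lemma eventually_jacobi_darboux:
  assumes \<theta>: "0 < \<theta>" "\<theta> < pi"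
  obtains C where "0 \<le> C" "\<forall>\<^sub>F n in sequentially.
      \<bar>darboux_weight \<alpha> \<beta> \<theta> * jacobi_poly \<alpha> \<beta> n (cos \<theta>)
            - 2 * jacobi_lead \<alpha> \<beta> n * cos (darboux_phase \<alpha> \<beta> \<theta> n)\<bar>
         \<le> C / real n * \<bar>jacobi_lead \<alpha> \<beta> n\<bar>"
proof -
  define Q where "Q = (\<bar>(\<alpha> + 1/2)\<^sup>2 - (\<alpha> + 1/2)\<bar> + \<bar>(\<beta> + 1/2)\<^sup>2 - (\<beta> + 1/2)\<bar>) / (sin \<theta>)\<^sup>2"
  have Q: "0 \<le> Q" by (simp add: Q_def)
  have "\<forall>\<^sub>F n in sequentially. 1 \<le> real n + (\<alpha> + \<beta> + 1) / 2" by real_asymp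
  moreover have "\<forall>\<^sub>F n in sequentially. 3 * Q \<le> real n + (\<alpha> + \<beta> + 1) / 2" by real_asymp
  moreover have "\<forall>\<^sub>F n in sequentially. real n / 2 \<le> real n + (\<alpha> + \<beta> + 1) / 2" by real_asymp
  ultimately have "\<forall>\<^sub>F n in sequentially.
      \<bar>darboux_weight \<alpha> \<beta> \<theta> * jacobi_poly \<alpha> \<beta> n (cos \<theta>)
            - 2 * jacobi_lead \<alpha> \<beta> n * cos (darboux_phase \<alpha> \<beta> \<theta> n)\<bar>
         \<le> 8 * Q / real n * \<bar>jacobi_lead \<alpha> \<beta> n\<bar>"
    using eventually_gt_at_top[of 0]
  proof eventually_elim
    case (elim n)
    have "4 * Q * \<bar>jacobi_lead \<alpha> \<beta> n\<bar> / (real n + (\<alpha> + \<beta> + 1) / 2)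
        \<le> 4 * Q * \<bar>jacobi_lead \<alpha> \<beta> n\<bar> / (real n / 2)"
      using elim Q by (intro divide_left_mono mult_nonneg_nonneg mult_pos_pos) auto
    then show ?case
      using jacobi_darboux[OF \<theta>, of n \<alpha> \<beta>, folded Q_def] elim by simp
  qed
  then show ?thesis using that[of "8 * Q"] Q by simp
qed

lemma darboux_weight_pos:
  assumes "0 < \<theta>" "\<theta> < pi"
  shows "0 < darboux_weight \<alpha> \<beta> \<theta>"
  using half_angle_pos[OF assms] by (simp add: darboux_weight_def)

text \<open>The product of the two Darboux formulas, with the product of cosines resolved into a sum.
  Each formula has an error of order \<open>\<lambda>\<^sub>n / n\<close>, and the amplitude is \<open>O(n\<^sup>-\<^sup>2)\<close>; therefore the
  remainder is \<open>O(n\<^sup>-\<^sup>3)\<close>.\<close>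
lemma jacobi_summand_expansion:
  fixes \<alpha> \<beta> \<theta> \<phi> :: real
  assumes \<theta>: "0 < \<theta>" "\<theta> < pi" and \<phi>: "0 < \<phi>" "\<phi> < pi"
  obtains c e B where "\<And>n. darboux_weight \<alpha> \<beta> \<theta> * darboux_weight \<alpha> \<beta> \<phi> * jacobi_summand \<alpha> \<beta> (cos \<theta>) (cos \<phi>) n
      = 2 * (jacobi_amplitude \<alpha> \<beta> n * cos (real n * (\<theta> - \<phi>) + (\<alpha> + \<beta> + 1) / 2 * (\<theta> - \<phi>)))
        + 2 * (jacobi_amplitude \<alpha> \<beta> n * cos (real n * (\<theta> + \<phi>) + c)) + e n"
    "\<forall>\<^sub>F n in sequentially. \<bar>e n\<bar> \<le> B / real n ^ 3"
proof -
  define K where "K = darboux_weight \<alpha> \<beta> \<theta>"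
  define K' where "K' = darboux_weight \<alpha> \<beta> \<phi>"
  define T where "T = jacobi_amplitude \<alpha> \<beta>"
  define u where "u = (\<lambda>n. K * jacobi_poly \<alpha> \<beta> n (cos \<theta>))"
  define u' where "u' = (\<lambda>n. K' * jacobi_poly \<alpha> \<beta> n (cos \<phi>))"
  define p where "p = (\<lambda>n. 2 * jacobi_lead \<alpha> \<beta> n * cos (darboux_phase \<alpha> \<beta> \<theta> n))"
  define p' where "p' = (\<lambda>n. 2 * jacobi_lead \<alpha> \<beta> n * cos (darboux_phase \<alpha> \<beta> \<phi> n))"
  define c where "c = (\<alpha> + \<beta> + 1) / 2 * (\<theta> + \<phi>) - (\<alpha> + 1/2) * pi"
  define e where "e = (\<lambda>n. jacobi_norm_factor \<alpha> \<beta> n * (u n * u' n - p n * p' n))"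
  have pp: "jacobi_norm_factor \<alpha> \<beta> n * (p n * p' n)
      = 2 * (T n * cos (real n * (\<theta> - \<phi>) + (\<alpha> + \<beta> + 1) / 2 * (\<theta> - \<phi>)))
        + 2 * (T n * cos (real n * (\<theta> + \<phi>) + c))" for n
  proof -
    have "darboux_phase \<alpha> \<beta> \<theta> n - darboux_phase \<alpha> \<beta> \<phi> n = real n * (\<theta> - \<phi>) + (\<alpha> + \<beta> + 1) / 2 * (\<theta> - \<phi>)"
      "darboux_phase \<alpha> \<beta> \<theta> n + darboux_phase \<alpha> \<beta> \<phi> n = real n * (\<theta> + \<phi>) + c"
      unfolding darboux_phase_def c_def by (simp_all add: field_simps)
    then have "2 * (cos (darboux_phase \<alpha> \<beta> \<theta> n) * cos (darboux_phase \<alpha> \<beta> \<phi> n))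
      = cos (real n * (\<theta> - \<phi>) + (\<alpha> + \<beta> + 1) / 2 * (\<theta> - \<phi>)) + cos (real n * (\<theta> + \<phi>) + c)"
      by (simp only: cos_times_cos) simp
    then have "2 * T n * (2 * (cos (darboux_phase \<alpha> \<beta> \<theta> n) * cos (darboux_phase \<alpha> \<beta> \<phi> n)))
      = 2 * T n * (cos (real n * (\<theta> - \<phi>) + (\<alpha> + \<beta> + 1) / 2 * (\<theta> - \<phi>)) + cos (real n * (\<theta> + \<phi>) + c))"
      by simp
    then show ?thesis
      unfolding p_def p'_def T_def jacobi_amplitude_def by (simp add: power2_eq_square algebra_simps)
  qed
  have split: "K * K' * jacobi_summand \<alpha> \<beta> (cos \<theta>) (cos \<phi>) n
      = 2 * (T n * cos (real n * (\<theta> - \<phi>) + (\<alpha> + \<beta> + 1) / 2 * (\<theta> - \<phi>)))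
        + 2 * (T n * cos (real n * (\<theta> + \<phi>) + c)) + e n" for n
    unfolding pp[symmetric] e_def u_def u'_def jacobi_summand_eq by (simp add: algebra_simps)
  obtain C where C: "0 \<le> C" "\<forall>\<^sub>F n in sequentially. \<bar>u n - p n\<bar> \<le> C / real n * \<bar>jacobi_lead \<alpha> \<beta> n\<bar>"
    using eventually_jacobi_darboux[OF \<theta>, of \<alpha> \<beta>] unfolding u_def p_def K_def by blast
  obtain C' where C': "0 \<le> C'" "\<forall>\<^sub>F n in sequentially. \<bar>u' n - p' n\<bar> \<le> C' / real n * \<bar>jacobi_lead \<alpha> \<beta> n\<bar>"
    using eventually_jacobi_darboux[OF \<phi>, of \<alpha> \<beta>] unfolding u'_def p'_def K'_def by blast
  define D where "D = C * (2 + C') + 2 * C'"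
  have D: "0 \<le> D" using C C' by (simp add: D_def)
  define S where "S = 2 powr (\<alpha> + \<beta>) / pi + 1"
  have "\<forall>\<^sub>F n in sequentially. (real n)\<^sup>2 * T n < S"
    using jacobi_amplitude_asymp unfolding T_def S_def by (rule order_tendstoD) simp
  then have "\<forall>\<^sub>F n in sequentially. \<bar>e n\<bar> \<le> D * S / real n ^ 3"
    using C(2) C'(2) jacobi_amplitude_eventually_decreasing[of \<alpha> \<beta>] eventually_args_pos[of \<alpha> \<beta>]
  proof eventually_elim
    case (elim n)
    define l where "l = \<bar>jacobi_lead \<alpha> \<beta> n\<bar>"
    have n: "1 \<le> real n" and l: "0 \<le> l" using elim by (auto simp: l_def)
    have W: "0 \<le> jacobi_norm_factor \<alpha> \<beta> n"
      unfolding jacobi_norm_factor_def using elim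
      by (intro divide_nonneg_nonneg mult_nonneg_nonneg less_imp_le[OF Gamma_real_pos]) auto
    have p: "\<bar>p n\<bar> \<le> 2 * l" "\<bar>p' n\<bar> \<le> 2 * l"
      unfolding p_def p'_def l_def abs_mult by (auto intro!: mult_left_le)
    have "C' / real n * l \<le> C' * l"
      using mult_left_mono[OF n C'(1)] n l by (intro mult_right_mono) (auto simp: divide_le_eq)
    moreover have "\<bar>u' n - p' n\<bar> \<le> C' / real n * l" using elim by (simp add: l_def)
    ultimately have u': "\<bar>u' n\<bar> \<le> (2 + C') * l"
      using p(2) unfolding distrib_right by linarith
    have "\<bar>u n * u' n - p n * p' n\<bar> = \<bar>(u n - p n) * u' n + p n * (u' n - p' n)\<bar>"
      by (simp add: algebra_simps)
    also have "\<dots> \<le> \<bar>u n - p n\<bar> * \<bar>u' n\<bar> + \<bar>p n\<bar> * \<bar>u' n - p' n\<bar>"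
      unfolding abs_mult[symmetric] by (rule abs_triangle_ineq)
    also have "\<dots> \<le> (C / real n * l) * ((2 + C') * l) + 2 * l * (C' / real n * l)"
      using elim u' p C(1) C'(1) l by (intro add_mono mult_mono) (auto simp: l_def)
    also have "\<dots> = D / real n * (jacobi_lead \<alpha> \<beta> n)\<^sup>2"
      unfolding D_def l_def power2_abs[of "jacobi_lead \<alpha> \<beta> n", symmetric]
      by (simp add: power2_eq_square algebra_simps add_divide_distrib)
    finally have "\<bar>e n\<bar> \<le> jacobi_norm_factor \<alpha> \<beta> n * (D / real n * (jacobi_lead \<alpha> \<beta> n)\<^sup>2)"
      unfolding e_def abs_mult abs_of_nonneg[OF W] by (rule mult_left_mono[OF _ W])
    also have "\<dots> = D / real n ^ 3 * ((real n)\<^sup>2 * T n)"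
      unfolding T_def jacobi_amplitude_def using n by (simp add: power2_eq_square power3_eq_cube)
    also have "\<dots> \<le> D / real n ^ 3 * S"
      using elim D n by (intro mult_left_mono) auto
    finally show ?case by simp
  qed
  then show ?thesis using that split unfolding K_def K'_def T_def by blast
qed

definition tail_sum :: "(nat \<Rightarrow> real) \<Rightarrow> nat \<Rightarrow> real" where
  "tail_sum f N = (\<Sum>k. f (N + 1 + k))"

lemma summable_tail: "summable f \<Longrightarrow> summable (\<lambda>k. f (N + 1 + k))" for f :: "nat \<Rightarrow> real"
  using summable_iff_shift[of f "N + 1"] by (simp add: add_ac)

lemma tail_sum_add:
  "summable f \<Longrightarrow> summable g \<Longrightarrow> tail_sum (\<lambda>n. f n + g n) N = tail_sum f N + tail_sum g N"
  unfolding tail_sum_def by (intro suminf_add[symmetric] summable_tail)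

lemma tail_sum_cmult: "summable f \<Longrightarrow> tail_sum (\<lambda>n. c * f n) N = c * tail_sum f N"
  unfolding tail_sum_def by (intro suminf_mult summable_tail)

lemma summable_jacobi_amplitude_cos:
  "summable (\<lambda>n. jacobi_amplitude \<alpha> \<beta> n * cos (real n * \<delta> + c))"
proof (rule summable_comparison_test_ev)
  show "summable (jacobi_amplitude \<alpha> \<beta>)"
    by (rule tendsto_tail(1)[OF jacobi_amplitude_asymp])
  show "\<forall>\<^sub>F n in sequentially. norm (jacobi_amplitude \<alpha> \<beta> n * cos (real n * \<delta> + c)) \<le> jacobi_amplitude \<alpha> \<beta> n"
    using jacobi_amplitude_eventually_decreasing[of \<alpha> \<beta>]
    by eventually_elim (auto simp: abs_mult intro!: mult_left_le)
qed

lemma tail_jacobi_amplitude_cos: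
  assumes "sin (\<delta> / 2) \<noteq> 0"
  shows "tail_sum (\<lambda>n. jacobi_amplitude \<alpha> \<beta> n * cos (real n * \<delta> + c)) \<in> O(\<lambda>N. 1 / (real N)\<^sup>2)"
proof -
  define T where "T = jacobi_amplitude \<alpha> \<beta>"
  obtain m where m: "\<And>n. n \<ge> m \<Longrightarrow> 0 \<le> T n \<and> T (Suc n) \<le> T n"
    using jacobi_amplitude_eventually_decreasing[of \<alpha> \<beta>] unfolding T_def eventually_sequentially by auto
  have "\<bar>tail_sum (\<lambda>n. T n * cos (real n * \<delta> + c)) N\<bar> \<le> T N / \<bar>sin (\<delta> / 2)\<bar>" if "N \<ge> m" for N
  proof -
    have "\<bar>tail_sum (\<lambda>n. T n * cos (real n * \<delta> + c)) N\<bar> \<le> T (N + 1) / \<bar>sin (\<delta> / 2)\<bar>"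
      unfolding tail_sum_def
      by (rule oscillating_tail[OF _ _ assms])
         (use m that summable_tail[OF summable_jacobi_amplitude_cos[of \<alpha> \<beta> \<delta> c], of N] in \<open>auto simp: T_def\<close>)
    also have "\<dots> \<le> T N / \<bar>sin (\<delta> / 2)\<bar>" using m[OF that] by (simp add: divide_right_mono)
    finally show ?thesis .
  qed
  then have "tail_sum (\<lambda>n. T n * cos (real n * \<delta> + c)) \<in> O(T)"
    using m by (intro bigoI[of _ "1 / \<bar>sin (\<delta> / 2)\<bar>"] eventually_sequentiallyI[of m]) auto
  also have "T \<in> O(\<lambda>N. 1 / (real N)\<^sup>2)"
  proof (rule bigoI_tendsto)
    show "(\<lambda>n. T n / (1 / (real n)\<^sup>2)) \<longlonglongrightarrow> 2 powr (\<alpha> + \<beta>) / pi"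
      using jacobi_amplitude_asymp[of \<alpha> \<beta>] by (simp add: T_def mult.commute)
    show "\<forall>\<^sub>F n in sequentially. 1 / (real n)\<^sup>2 \<noteq> 0"
      using eventually_gt_at_top[of 0] by eventually_elim simp
  qed
  finally show ?thesis by (simp add: T_def)
qed

lemma tail_cubic:
  assumes "\<forall>\<^sub>F n in sequentially. \<bar>e n\<bar> \<le> B / real n ^ 3"
  shows "summable e" "tail_sum e \<in> O(\<lambda>N. 1 / (real N)\<^sup>2)"
proof -
  show "summable e"
  proof (rule summable_comparison_test_ev)
    show "\<forall>\<^sub>F n in sequentially. norm (e n) \<le> B * inverse (real n ^ 3)"
      using assms by (simp add: field_simps)
    show "summable (\<lambda>n. B * inverse (real n ^ 3))"
      by (intro summable_mult inverse_power_summable) simp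
  qed
  obtain m where m: "\<And>n. n \<ge> m \<Longrightarrow> \<bar>e n\<bar> \<le> B / real n ^ 3"
    using assms unfolding eventually_sequentially by auto
  have "\<bar>tail_sum e N\<bar> \<le> B / (real N)\<^sup>2" if "N \<ge> max 1 m" for N
    unfolding tail_sum_def using that by (intro cube_tail m) auto
  then show "tail_sum e \<in> O(\<lambda>N. 1 / (real N)\<^sup>2)"
    by (intro bigoI[of _ B] eventually_sequentiallyI[of "max 1 m"]) auto
qed

lemma powr_tail_tendsto_0:
  assumes "f \<in> O(\<lambda>N. 1 / (real N)\<^sup>2)" "\<gamma> < 2"
  shows "(\<lambda>N. real N powr \<gamma> * f N) \<longlonglongrightarrow> 0"
proof -
  have "(\<lambda>N. real N powr \<gamma> * f N) \<in> O(\<lambda>N. real N powr \<gamma> * (1 / (real N)\<^sup>2))"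
    by (intro landau_o.big.mult_left assms(1))
  also have "(\<lambda>N. real N powr \<gamma> * (1 / (real N)\<^sup>2)) \<in> o(\<lambda>N. 1)"
    using assms(2) by real_asymp
  finally show ?thesis by (auto dest: smalloD_tendsto)
qed

text \<open>Half-angle formulas again: \<open>4 sin\<^sup>2 (\<theta>/2) = 2 (1 - x)\<close> and \<open>4 cos\<^sup>2 (\<theta>/2) = 2 (1 + x)\<close>.\<close>
lemma darboux_weight_square:
  assumes x: "-1 < x" "x < 1"
  shows "darboux_weight \<alpha> \<beta> (arccos x) * darboux_weight \<alpha> \<beta> (arccos x)
    = 2 powr (\<alpha> + \<beta> + 1) * ((1 - x) powr (\<alpha> + 1/2) * (1 + x) powr (\<beta> + 1/2))"
proof -
  define \<theta> where "\<theta> = arccos x"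
  have \<theta>: "0 < \<theta>" "\<theta> < pi" and cos: "cos \<theta> = x"
    using x arccos_lt_bounded[of x] by (auto simp: \<theta>_def)
  have pos: "0 < 2 * sin (\<theta> / 2)" "0 < 2 * cos (\<theta> / 2)"
    using half_angle_pos[OF \<theta>] by auto
  have s: "(2 * sin (\<theta> / 2)) * (2 * sin (\<theta> / 2)) = 2 * (1 - x)"
    using cos_double_sin[of "\<theta> / 2"] cos by (simp add: power2_eq_square)
  have c: "(2 * cos (\<theta> / 2)) * (2 * cos (\<theta> / 2)) = 2 * (1 + x)"
    using cos_double_cos[of "\<theta> / 2"] cos by (simp add: power2_eq_square)
  have one_minus: "0 < 1 - x" and one_plus: "0 < 1 + x" using x by auto
  have two: "(2 * p) powr t = 2 powr t * p powr t" if "0 < p" for p t :: real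
    using that by (simp add: powr_mult)
  have sq: "p powr t * p powr t = (p * p) powr t" if "0 < p" for p t :: real
    using that by (simp add: powr_mult)
  have "darboux_weight \<alpha> \<beta> \<theta> * darboux_weight \<alpha> \<beta> \<theta>
     = ((2 * sin (\<theta> / 2)) * (2 * sin (\<theta> / 2))) powr (\<alpha> + 1/2)
       * ((2 * cos (\<theta> / 2)) * (2 * cos (\<theta> / 2))) powr (\<beta> + 1/2)"
    unfolding darboux_weight_def
      sq[OF pos(1), symmetric] sq[OF pos(2), symmetric] by (simp only: mult_ac)
  also have "\<dots> = 2 powr (\<alpha> + 1/2) * 2 powr (\<beta> + 1/2) * ((1 - x) powr (\<alpha> + 1/2) * (1 + x) powr (\<beta> + 1/2))"
    unfolding s c two[OF one_minus] two[OF one_plus] by (simp only: mult_ac)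
  also have "2 powr (\<alpha> + 1/2) * 2 powr (\<beta> + 1/2) = (2::real) powr (\<alpha> + \<beta> + 1)"
    by (simp add: add_ac flip: powr_add)
  finally show ?thesis by (simp add: \<theta>_def)
qed

theorem theorem1p5:
  fixes \<alpha> \<beta> :: real
  shows "(\<forall>x\<in>{-1<..<1}.
            summable (jacobi_summand \<alpha> \<beta> x x) \<and>
            (\<lambda>N. real N * (\<Sum>k. jacobi_summand \<alpha> \<beta> x x (N + 1 + k)))
              \<longlonglongrightarrow> (1 - x) powr (- \<alpha> - 1/2) * (1 + x) powr (- \<beta> - 1/2) / pi) \<and>
         (\<forall>x\<in>{-1<..<1}. \<forall>y\<in>{-1<..<1}. x \<noteq> y \<longrightarrow>
            summable (jacobi_summand \<alpha> \<beta> x y) \<and>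
            (\<forall>\<gamma><2.
               (\<lambda>N. real N powr \<gamma> * (\<Sum>k. jacobi_summand \<alpha> \<beta> x y (N + 1 + k)))
                 \<longlonglongrightarrow> 0))"
proof (intro conjI ballI impI)
  define T where "T = jacobi_amplitude \<alpha> \<beta>"
  define osc where "osc = (\<lambda>\<delta> c n. T n * cos (real n * \<delta> + c))"
  have osc_summable: "summable (osc \<delta> c)" for \<delta> c
    unfolding osc_def T_def by (rule summable_jacobi_amplitude_cos)
  have osc_tail: "tail_sum (osc \<delta> c) \<in> O(\<lambda>N. 1 / (real N)\<^sup>2)" if "sin (\<delta> / 2) \<noteq> 0" for \<delta> c
    unfolding osc_def T_def by (rule tail_jacobi_amplitude_cos[OF that])
  \<comment> \<open>Up to \<open>O(N\<^sup>-\<^sup>2)\<close>, the tail is that of the cosines of the difference of the two angles, because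
    half the sum of the angles lies strictly between \<open>0\<close> and \<open>\<pi>\<close>.\<close>
  have expand: "\<exists>r. summable (jacobi_summand \<alpha> \<beta> x y) \<and> r \<in> O(\<lambda>N. 1 / (real N)\<^sup>2) \<and>
      (\<forall>N. darboux_weight \<alpha> \<beta> (arccos x) * darboux_weight \<alpha> \<beta> (arccos y) * tail_sum (jacobi_summand \<alpha> \<beta> x y) N
        = 2 * tail_sum (osc (arccos x - arccos y) ((\<alpha> + \<beta> + 1) / 2 * (arccos x - arccos y))) N + r N)"
    if x: "x \<in> {-1<..<1}" and y: "y \<in> {-1<..<1}" for x y
  proof -
    define \<theta> \<phi> where "\<theta> = arccos x" and "\<phi> = arccos y"
    have \<theta>: "0 < \<theta>" "\<theta> < pi" "cos \<theta> = x" and \<phi>: "0 < \<phi>" "\<phi> < pi" "cos \<phi> = y"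
      using x y arccos_lt_bounded[of x] arccos_lt_bounded[of y] by (auto simp: \<theta>_def \<phi>_def)
    define K where "K = darboux_weight \<alpha> \<beta> \<theta> * darboux_weight \<alpha> \<beta> \<phi>"
    have K: "K \<noteq> 0"
      using darboux_weight_pos[OF \<theta>(1,2), of \<alpha> \<beta>] darboux_weight_pos[OF \<phi>(1,2), of \<alpha> \<beta>] by (simp add: K_def)
    define c1 where "c1 = (\<alpha> + \<beta> + 1) / 2 * (\<theta> - \<phi>)"
    obtain c e B where split0: "\<And>n. darboux_weight \<alpha> \<beta> \<theta> * darboux_weight \<alpha> \<beta> \<phi> * jacobi_summand \<alpha> \<beta> (cos \<theta>) (cos \<phi>) n
      = 2 * (jacobi_amplitude \<alpha> \<beta> n * cos (real n * (\<theta> - \<phi>) + (\<alpha> + \<beta> + 1) / 2 * (\<theta> - \<phi>)))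
        + 2 * (jacobi_amplitude \<alpha> \<beta> n * cos (real n * (\<theta> + \<phi>) + c)) + e n"
      and e: "\<forall>\<^sub>F n in sequentially. \<bar>e n\<bar> \<le> B / real n ^ 3"
      by (rule jacobi_summand_expansion[where \<alpha> = \<alpha> and \<beta> = \<beta>, OF \<theta>(1,2) \<phi>(1,2)])
         (rule that)
    have split: "K * jacobi_summand \<alpha> \<beta> x y n = 2 * osc (\<theta> - \<phi>) c1 n + 2 * osc (\<theta> + \<phi>) c n + e n" for n
      using split0[of n] unfolding K_def osc_def T_def c1_def \<theta>(3) \<phi>(3) .
    have sum1: "summable (\<lambda>n. 2 * osc (\<theta> - \<phi>) c1 n)" and sum2: "summable (\<lambda>n. 2 * osc (\<theta> + \<phi>) c n)"
      by (intro summable_mult osc_summable)+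
    have "summable (\<lambda>n. K * jacobi_summand \<alpha> \<beta> x y n)"
      unfolding split by (intro summable_add sum1 sum2 tail_cubic(1)[OF e])
    then have summ: "summable (jacobi_summand \<alpha> \<beta> x y)" using K by simp
    have "sin ((\<theta> + \<phi>) / 2) \<noteq> 0"
      using sin_gt_zero[of "(\<theta> + \<phi>) / 2"] \<theta> \<phi> by simp
    then have r: "(\<lambda>N. 2 * tail_sum (osc (\<theta> + \<phi>) c) N + tail_sum e N) \<in> O(\<lambda>N. 1 / (real N)\<^sup>2)"
      using osc_tail tail_cubic(2)[OF e] by (intro sum_in_bigo) auto
    have "K * tail_sum (jacobi_summand \<alpha> \<beta> x y) N
        = 2 * tail_sum (osc (\<theta> - \<phi>) c1) N + (2 * tail_sum (osc (\<theta> + \<phi>) c) N + tail_sum e N)" for N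
      unfolding tail_sum_cmult[OF summ, symmetric] split
      using tail_sum_add[OF summable_add[OF sum1 sum2] tail_cubic(1)[OF e]] tail_sum_add[OF sum1 sum2]
        tail_sum_cmult[OF osc_summable] by simp
    with summ r show ?thesis unfolding K_def \<theta>_def \<phi>_def c1_def by blast
  qed
  {
    fix x :: real assume x: "x \<in> {-1<..<1}"
    define K where "K = darboux_weight \<alpha> \<beta> (arccos x) * darboux_weight \<alpha> \<beta> (arccos x)"
    obtain r where summ: "summable (jacobi_summand \<alpha> \<beta> x x)" and r: "r \<in> O(\<lambda>N. 1 / (real N)\<^sup>2)"
      and eq0: "\<forall>N. K * tail_sum (jacobi_summand \<alpha> \<beta> x x) N
        = 2 * tail_sum (osc (arccos x - arccos x) ((\<alpha> + \<beta> + 1) / 2 * (arccos x - arccos x))) N + r N"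
      using expand[OF x x] unfolding K_def by blast
    have "osc (arccos x - arccos x) ((\<alpha> + \<beta> + 1) / 2 * (arccos x - arccos x)) = T"
      by (simp add: osc_def)
    with eq0 have eq: "K * tail_sum (jacobi_summand \<alpha> \<beta> x x) N = 2 * tail_sum T N + r N" for N
      by simp
    show "summable (jacobi_summand \<alpha> \<beta> x x)" by (rule summ)
    have K: "K = 2 powr (\<alpha> + \<beta> + 1) * ((1 - x) powr (\<alpha> + 1/2) * (1 + x) powr (\<beta> + 1/2))"
      unfolding K_def using x by (intro darboux_weight_square) auto
    have K0: "K \<noteq> 0" using x by (simp add: K)
    have "(\<lambda>N. real N * tail_sum T N) \<longlonglongrightarrow> 2 powr (\<alpha> + \<beta>) / pi"
      unfolding tail_sum_def T_def by (rule tendsto_tail(2)[OF jacobi_amplitude_asymp])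
    moreover have "(\<lambda>N. real N * r N) \<longlonglongrightarrow> 0"
      using powr_tail_tendsto_0[OF r, of 1] by simp
    ultimately have "(\<lambda>N. (2 * (real N * tail_sum T N) + real N * r N) / K)
        \<longlonglongrightarrow> (2 * (2 powr (\<alpha> + \<beta>) / pi) + 0) / K"
      by (intro tendsto_intros K0)
    moreover have "(2 * (real N * tail_sum T N) + real N * r N) / K = real N * tail_sum (jacobi_summand \<alpha> \<beta> x x) N" for N
    proof -
      have "2 * (real N * tail_sum T N) + real N * r N = real N * (2 * tail_sum T N + r N)"
        by (simp add: algebra_simps)
      then show ?thesis using K0 by (simp only: eq[symmetric]) simp
    qed
    moreover have "(2 * (2 powr (\<alpha> + \<beta>) / pi) + 0) / K = (1 - x) powr (- \<alpha> - 1/2) * (1 + x) powr (- \<beta> - 1/2) / pi"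
    proof -
      have neg: "- \<alpha> - 1/2 = - (\<alpha> + 1/2)" "- \<beta> - 1/2 = - (\<beta> + 1/2)" by auto
      show ?thesis
        unfolding K neg powr_minus powr_add[of _ "\<alpha> + \<beta>" 1] using x by (simp add: field_simps)
    qed
    ultimately show "(\<lambda>N. real N * (\<Sum>k. jacobi_summand \<alpha> \<beta> x x (N + 1 + k)))
        \<longlonglongrightarrow> (1 - x) powr (- \<alpha> - 1/2) * (1 + x) powr (- \<beta> - 1/2) / pi"
      by (simp add: tail_sum_def)
  }
  {
    fix x y :: real assume x: "x \<in> {-1<..<1}" and y: "y \<in> {-1<..<1}" and "x \<noteq> y"
    define K where "K = darboux_weight \<alpha> \<beta> (arccos x) * darboux_weight \<alpha> \<beta> (arccos y)"
    define \<delta> where "\<delta> = arccos x - arccos y"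
    have \<theta>: "0 < arccos x" "arccos x < pi" and \<phi>: "0 < arccos y" "arccos y < pi"
      using x y arccos_lt_bounded[of x] arccos_lt_bounded[of y] by auto
    have K0: "K \<noteq> 0"
      using darboux_weight_pos[OF \<theta>, of \<alpha> \<beta>] darboux_weight_pos[OF \<phi>, of \<alpha> \<beta>] by (simp add: K_def)
    have "cos (arccos x) = x" "cos (arccos y) = y" using x y by auto
    then have "\<delta> \<noteq> 0"
      using \<open>x \<noteq> y\<close> unfolding \<delta>_def by (metis eq_iff_diff_eq_0)
    moreover have "- pi < \<delta>" "\<delta> < pi" using \<theta> \<phi> by (auto simp: \<delta>_def)
    ultimately have "sin (\<delta> / 2) \<noteq> 0"
      using sin_gt_zero[of "\<delta> / 2"] sin_gt_zero[of "- (\<delta> / 2)"] by (cases "\<delta> > 0") auto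
    moreover obtain r where summ: "summable (jacobi_summand \<alpha> \<beta> x y)" and r: "r \<in> O(\<lambda>N. 1 / (real N)\<^sup>2)"
      and eq: "\<forall>N. K * tail_sum (jacobi_summand \<alpha> \<beta> x y) N = 2 * tail_sum (osc \<delta> ((\<alpha> + \<beta> + 1) / 2 * \<delta>)) N + r N"
      using expand[OF x y] unfolding K_def \<delta>_def by blast
    ultimately have "(\<lambda>N. (2 * tail_sum (osc \<delta> ((\<alpha> + \<beta> + 1) / 2 * \<delta>)) N + r N) / K) \<in> O(\<lambda>N. 1 / (real N)\<^sup>2)"
      using osc_tail by (auto intro!: sum_in_bigo simp: K0)
    moreover have "(\<lambda>N. (2 * tail_sum (osc \<delta> ((\<alpha> + \<beta> + 1) / 2 * \<delta>)) N + r N) / K) = tail_sum (jacobi_summand \<alpha> \<beta> x y)"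
      using K0 by (simp only: eq[rule_format, symmetric]) simp
    ultimately have tail: "tail_sum (jacobi_summand \<alpha> \<beta> x y) \<in> O(\<lambda>N. 1 / (real N)\<^sup>2)" by simp
    show "summable (jacobi_summand \<alpha> \<beta> x y)" by (rule summ)
    show "\<forall>\<gamma><2. (\<lambda>N. real N powr \<gamma> * (\<Sum>k. jacobi_summand \<alpha> \<beta> x y (N + 1 + k))) \<longlonglongrightarrow> 0"
      using powr_tail_tendsto_0[OF tail] unfolding tail_sum_def by blast
  }
qed

end
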